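(* Let $R>1$, $0<\epsilon<1$ and $C_0\in\mathbb{R}$, and let $v$ be a (smooth) solution of the boundary value problem $$\begin{cases}\Delta v+2C_0^2e^v=0 & \text{in } A(1-\epsilon,R+\epsilon),\\ \frac{\partial v}{\partial n}=2e^{-\frac12 v}-2 & \text{on } |z|=1,\\ \frac{\partial v}{\partial n}=\frac{2}{R^2}e^{-\frac12 v}+\frac{2}{R} & \text{on } |z|=R,\end{cases}$$ where $A(a,b)=\{z\in\mathbb{C}: a<|z|<b\}$, $\Delta=4\frac{\partial}{\partial z}\frac{\partial}{\partial\bar z}$, and $n$ is the inner unit normal to $A(1,R)$. For $0\le\delta<1$ let $H_{R,\delta}=\{\xi\in\mathbb{C}:\log(1-\delta)<\operatorname{Im}\xi<\log(R+\delta)\}$ and $H^0_{R,\delta}=H_{R,\delta}\cap\{\xi: 0\le\operatorname{Re}\xi\le 2\pi\}$. Then there exist a minimal immersion $X:H_{R,\epsilon}\to\mathbb{R}^3$ and unit spheres $S_{O_1}$, $S_{O_2}$ (centered at $O_1$ and $O_2$ respectively) such that: (1) if $\Lambda$ denotes the conformal factor of $X$, i.e. the induced metric is $\Lambda^2|d\xi|^2$, then $v(e^{-i\xi})=\log\frac{1}{\Lambda^2(\xi)|e^{-i\xi}|^2}$ for all $\xi\in H_{R,\epsilon}$; (2) $S_{O_1}$ and $S_{O_2}$ intersect $X(H_{R,\epsilon})$ orthogonally along the level curves $\operatorname{Im}\xi=0$ and $\operatorname{Im}\xi=\log R$, respectively; (3) there is a rigid motion $T$ of $\mathbb{R}^3$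 with $T\cdot X(H^0_{R,\epsilon})=X(H^0_{R,\epsilon}+2\pi)$ and $X(H_{R,\epsilon})=\bigcup_{n\in\mathbb{Z}}T^n\cdot X(H^0_{R,\epsilon})$.
   Context: $H_{R,\epsilon}$ is the universal cover of $A(1-\epsilon,R+\epsilon)$ via the covering map $z=e^{-i\xi}$. The set $X(H^0_{R,0})$ is called a fundamental piece. *)

theory Defs
  imports "HOL-Analysis.Analysis"
begin

definition pdx :: "(complex \<Rightarrow> 'a::real_normed_vector) \<Rightarrow> complex \<Rightarrow> 'a" where
  "pdx f z = vector_derivative (\<lambda>t::real. f (z + complex_of_real t)) (at 0)"

definition pdy :: "(complex \<Rightarrow> 'a::real_normed_vector) \<Rightarrow> complex \<Rightarrow> 'a" where
  "pdy f z = vector_derivative (\<lambda>t::real. f (z + \<i> * complex_of_real t)) (at 0)"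

definition dirderiv :: "(complex \<Rightarrow> real) \<Rightarrow> complex \<Rightarrow> complex \<Rightarrow> real" where
  "dirderiv f z n = vector_derivative (\<lambda>t::real. f (z + complex_of_real t * n)) (at 0)"

definition C2_on :: "complex set \<Rightarrow> (complex \<Rightarrow> 'a::real_normed_vector) \<Rightarrow> bool" where
  "C2_on S f \<longleftrightarrow> open S \<and>
     (\<forall>z\<in>S. f differentiable at z \<and> pdx f differentiable at z \<and> pdy f differentiable at z) \<and>
     continuous_on S (pdx (pdx f)) \<and> continuous_on S (pdx (pdy f)) \<and>
     continuous_on S (pdy (pdx f)) \<and> continuous_on S (pdy (pdy f))"

definition laplacian :: "(complex \<Rightarrow> real) \<Rightarrow> complex \<Rightarrow> real" where
  "laplacian f z = pdx (pdx f) z + pdy (pdy f) z"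

definition annulus :: "real \<Rightarrow> real \<Rightarrow> complex set" where
  "annulus a b = {z. a < cmod z \<and> cmod z < b}"

definition strip :: "real \<Rightarrow> real \<Rightarrow> complex set" where
  "strip R \<delta> = {\<xi>. ln (1 - \<delta>) < Im \<xi> \<and> Im \<xi> < ln (R + \<delta>)}"

definition strip0 :: "real \<Rightarrow> real \<Rightarrow> complex set" where
  "strip0 R \<delta> = strip R \<delta> \<inter> {\<xi>. 0 \<le> Re \<xi> \<and> Re \<xi> \<le> 2 * pi}"

definition surf_normal :: "(complex \<Rightarrow> real^3) \<Rightarrow> complex \<Rightarrow> real^3" where
  "surf_normal X \<xi> = (let n = cross3 (pdx X \<xi>) (pdy X \<xi>) in (1 / norm n) *\<^sub>R n)"

definition mean_curvature :: "(complex \<Rightarrow> real^3) \<Rightarrow> complex \<Rightarrow> real" where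
  "mean_curvature X \<xi> =
     (let Xu = pdx X \<xi>; Xv = pdy X \<xi>; \<nu> = surf_normal X \<xi>;
          E = Xu \<bullet> Xu; F = Xu \<bullet> Xv; G = Xv \<bullet> Xv;
          L = pdx (pdx X) \<xi> \<bullet> \<nu>; M = pdy (pdx X) \<xi> \<bullet> \<nu>; N = pdy (pdy X) \<xi> \<bullet> \<nu>
      in (E * N - 2 * F * M + G * L) / (2 * (E * G - F\<^sup>2)))"

definition immersion_on :: "complex set \<Rightarrow> (complex \<Rightarrow> real^3) \<Rightarrow> bool" where
  "immersion_on S X \<longleftrightarrow> C2_on S X \<and> (\<forall>\<xi>\<in>S. cross3 (pdx X \<xi>) (pdy X \<xi>) \<noteq> 0)"

definition minimal_immersion_on :: "complex set \<Rightarrow> (complex \<Rightarrow> real^3) \<Rightarrow> bool" where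
  "minimal_immersion_on S X \<longleftrightarrow> immersion_on S X \<and> (\<forall>\<xi>\<in>S. mean_curvature X \<xi> = 0)"

definition conformal_factor_on :: "complex set \<Rightarrow> (complex \<Rightarrow> real^3) \<Rightarrow> (complex \<Rightarrow> real) \<Rightarrow> bool" where
  "conformal_factor_on S X \<Lambda> \<longleftrightarrow> (\<forall>\<xi>\<in>S. \<Lambda> \<xi> > 0 \<and>
      pdx X \<xi> \<bullet> pdx X \<xi> = (\<Lambda> \<xi>)\<^sup>2 \<and> pdy X \<xi> \<bullet> pdy X \<xi> = (\<Lambda> \<xi>)\<^sup>2 \<and> pdx X \<xi> \<bullet> pdy X \<xi> = 0)"

text \<open>The unit sphere centred at O meets the surface X orthogonally along the curve X(C):
  the curve lies on the sphere and the surface normal is tangent to the sphere there.\<close>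
definition meets_orthogonally_along ::
  "real^3 \<Rightarrow> (complex \<Rightarrow> real^3) \<Rightarrow> complex set \<Rightarrow> bool" where
  "meets_orthogonally_along c X C \<longleftrightarrow>
     (\<forall>\<xi>\<in>C. X \<xi> \<in> sphere c 1 \<and> surf_normal X \<xi> \<bullet> (X \<xi> - c) = 0)"

definition rigid_motion :: "(real^3 \<Rightarrow> real^3) \<Rightarrow> bool" where
  "rigid_motion T \<longleftrightarrow> (\<exists>A b. rotation_matrix A \<and> T = (\<lambda>x. A *v x + b))"

definition ipow :: "('a \<Rightarrow> 'a) \<Rightarrow> int \<Rightarrow> ('a \<Rightarrow> 'a)" where
  "ipow T n = (if 0 \<le> n then T ^^ nat n else inv T ^^ nat (- n))"

end

theory Submission
  imports Defs
begin

text \<open>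
  Put \<open>\<xi> = s + \<i> t\<close> and \<open>w(\<xi>) = - v(e\<^bsup>-\<i>\<xi>\<^esup>)/2 - t\<close>. The equation for \<open>v\<close> becomes \<open>w\<^sub>s\<^sub>s + w\<^sub>t\<^sub>t = C\<^sub>0\<^sup>2 e\<^bsup>-2w\<^esup>\<close>,
  which is the Gauss equation of a minimal surface with metric \<open>e\<^bsup>2w\<^esup> |d\<xi>|\<^sup>2\<close> and second fundamental form
  \<open>C\<^sub>0 (ds\<^sup>2 - dt\<^sup>2)\<close>. Hence the linear system for the orthonormal frame \<open>(e\<^sub>1, e\<^sub>2, n)\<close> and the position \<open>X\<close>
  is integrable on the strip. The boundary conditions say \<open>w\<^sub>t = -e\<^sup>w\<close> on \<open>t = 0\<close> and \<open>w\<^sub>t = e\<^sup>w\<close> on \<open>t = ln R\<close>,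
  which makes \<open>X + e\<^sub>2\<close>, respectively \<open>X - e\<^sub>2\<close>, constant along these lines: these are the centres of the spheres.
  Since \<open>w\<close> is \<open>2\<pi>\<close>-periodic in \<open>s\<close>, translation by \<open>2\<pi>\<close> maps the solution of the frame system to another one,
  and by uniqueness the two differ by a rigid motion.
\<close>

section \<open>Linear differential equations and flat connections\<close>

text \<open>Picard series: the iterated integrals of \<open>A\<close> applied to \<open>y0\<close>
  are at most \<open>norm y0 * (K * t) ^ n / fact n\<close>, so their sum converges uniformly and
  can be differentiated term by term.\<close>

lemma linear_ode_exists:
  fixes A :: "real \<Rightarrow> 'e \<Rightarrow>\<^sub>L 'e::banach"
  assumes A: "continuous_on {0..1} A"
  obtains y where "y 0 = y0"
    "\<And>t. t \<in> {0..1} \<Longrightarrow> (y has_vector_derivative A t (y t)) (at t within {0..1})"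
proof -
  \<comment> \<open>\<open>u n\<close> is the n-th summand of the series, not the n-th Picard
    iterate.\<close>
  define u where "u = rec_nat (\<lambda>t. y0) (\<lambda>n f t. integral {0..t} (\<lambda>s. A s (f s)))"
  have u0: "u 0 = (\<lambda>t. y0)" and uS: "u (Suc n) = (\<lambda>t. integral {0..t} (\<lambda>s. A s (u n s)))" for n
    by (simp_all add: u_def)
  obtain K where K: "K > 0" "\<And>t. t \<in> {0..1} \<Longrightarrow> norm (A t) \<le> K"
    using compact_imp_bounded[OF compact_continuous_image[OF A compact_Icc]]
    unfolding bounded_pos by auto
  have cont: "continuous_on {0..1} (u n)" for n
  proof (induction n)
    case 0
    then show ?case by (simp add: u0)
  next
    case (Suc n)
    then show ?case unfolding uS
      by (intro indefinite_integral_continuous_1 integrable_continuous_real continuous_intros A)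
  qed
  have der: "(u (Suc n) has_vector_derivative A t (u n t)) (at t within {0..1})"
    if "t \<in> {0..1}" for n t
    unfolding uS using that by (intro integral_has_vector_derivative continuous_intros A cont)
  define M where "M n = norm y0 * (K ^ n / fact n)" for n
  have bnd: "norm (u n t) \<le> M n * t ^ n" if "t \<in> {0..1}" for n t
    using that
  proof (induction n arbitrary: t)
    case 0
    then show ?case by (simp add: u0 M_def)
  next
    case (Suc n)
    have I: "((\<lambda>s. K * M n * s ^ n) has_integral (M (Suc n) * t ^ Suc n - M (Suc n) * 0 ^ Suc n)) {0..t}"
    proof (rule fundamental_theorem_of_calculus)
      have "M (Suc n) * real (Suc n) = K * M n"
        by (simp add: M_def field_simps del: of_nat_Suc)
      then show "((\<lambda>s. M (Suc n) * s ^ Suc n) has_vector_derivative K * M n * s ^ n) (at s within {0..t})" for s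
        using DERIV_cmult[OF DERIV_pow[of "Suc n" s "{0..t}"], of "M (Suc n)"]
        by (simp add: has_real_derivative_iff_has_vector_derivative mult.assoc [symmetric] del: of_nat_Suc power_Suc)
    qed (use Suc.prems in auto)
    have "norm (u (Suc n) t) \<le> integral {0..t} (\<lambda>s. K * M n * s ^ n)"
      unfolding uS
    proof (rule integral_norm_bound_integral)
      show "(\<lambda>s. A s (u n s)) integrable_on {0..t}"
        using Suc.prems by (intro integrable_continuous_real continuous_intros
          continuous_on_subset[OF A] continuous_on_subset[OF cont]) auto
      show "(\<lambda>s. K * M n * s ^ n) integrable_on {0..t}"
        by (intro integrable_continuous_real continuous_intros)
      fix s assume s: "s \<in> {0..t}"
      have "norm (A s (u n s)) \<le> norm (A s) * norm (u n s)" by (rule norm_blinfun)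
      also have "\<dots> \<le> K * (M n * s ^ n)"
        using s Suc.prems by (intro mult_mono K Suc.IH) (use K in auto)
      finally show "norm (A s (u n s)) \<le> K * M n * s ^ n" by (simp add: mult.assoc)
    qed
    also have "integral {0..t} (\<lambda>s. K * M n * s ^ n) = M (Suc n) * t ^ Suc n"
      by (rule trans[OF integral_unique[OF I]]) simp
    finally show ?case .
  qed
  have bnd1: "norm (u n t) \<le> M n" if "t \<in> {0..1}" for n t
  proof -
    have "M n * t ^ n \<le> M n * 1"
      using that K(1) by (intro mult_left_mono power_le_one) (auto simp: M_def)
    with bnd[OF that, of n] show ?thesis by simp
  qed
  have sM: "summable M"
    unfolding M_def using summable_exp[of K] by (intro summable_mult) (simp add: field_simps)
  have su: "summable (\<lambda>n. u n t)" if "t \<in> {0..1}" for t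
    using bnd1[OF that] by (intro summable_comparison_test'[OF sM]) auto
  define y where "y t = (\<Sum>n. u n t)" for t
  have ysums: "(\<lambda>n. u n t) sums y t" if "t \<in> {0..1}" for t
    using su[OF that] unfolding y_def by (rule summable_sums)
  \<comment> \<open>The constant summand has derivative 0 and summand \<open>Suc m\<close> has
    derivative \<open>A t (u m t)\<close>. Hence the first \<open>Suc n\<close> derivatives add up
    to \<open>A t\<close> of the first \<open>n\<close> summands, which causes the index shift
    below.\<close>
  define f' where "f' n t h = (case n of 0 \<Rightarrow> 0 | Suc m \<Rightarrow> h *\<^sub>R A t (u m t))" for n t and h :: real
  have lim: "uniform_limit {0..1} (\<lambda>n t. \<Sum>i<n. u i t) y sequentially"
    unfolding y_def by (rule Weierstrass_m_test[OF bnd1 sM])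
  have "\<exists>g. \<forall>t\<in>{0..1}. (\<lambda>n. u n t) sums (g t) \<and> (g has_derivative (\<lambda>h. h *\<^sub>R A t (y t))) (at t within {0..1})"
  proof (rule has_derivative_series[where f' = f'])
    show "convex {0..1::real}" by simp
    show "(u n has_derivative f' n t) (at t within {0..1})" if "t \<in> {0..1}" for n t
    proof (cases n)
      case 0
      then show ?thesis by (simp add: u0 f'_def[abs_def])
    next
      case (Suc m)
      then show ?thesis using der[OF that, of m] by (simp add: f'_def[abs_def] has_vector_derivative_def)
    qed
    show "\<forall>\<^sub>F n in sequentially. \<forall>t\<in>{0..1}. \<forall>h. norm ((\<Sum>i<n. f' i t h) - h *\<^sub>R A t (y t)) \<le> e * norm h"
      if "e > 0" for e
    proof -
      have "\<forall>\<^sub>F n in sequentially. \<forall>t\<in>{0..1}. dist (\<Sum>i<n. u i t) (y t) < e / K"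
        using lim K(1) that unfolding uniform_limit_iff by simp
      then have "\<forall>\<^sub>F n in sequentially. \<forall>t\<in>{0..1}. \<forall>h. norm ((\<Sum>i<Suc n. f' i t h) - h *\<^sub>R A t (y t)) \<le> e * norm h"
      proof eventually_elim
        case (elim n)
        show ?case
        proof (intro ballI allI)
          fix t h :: real assume t: "t \<in> {0..1}"
          have "(\<Sum>i<Suc n. f' i t h) - h *\<^sub>R A t (y t) = h *\<^sub>R A t ((\<Sum>i<n. u i t) - y t)"
            unfolding sum.lessThan_Suc_shift
            by (simp add: f'_def blinfun.sum_right blinfun.diff_right scaleR_right.sum scaleR_right_diff_distrib)
          then have "norm ((\<Sum>i<Suc n. f' i t h) - h *\<^sub>R A t (y t)) = norm h * norm (A t ((\<Sum>i<n. u i t) - y t))"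
            by simp
          also have "\<dots> \<le> norm h * (norm (A t) * norm ((\<Sum>i<n. u i t) - y t))"
            by (intro mult_left_mono norm_blinfun) auto
          also have "\<dots> \<le> norm h * (K * (e / K))"
            using elim t K by (intro mult_left_mono mult_mono) (auto simp: dist_norm intro: less_imp_le)
          finally show "norm ((\<Sum>i<Suc n. f' i t h) - h *\<^sub>R A t (y t)) \<le> e * norm h"
            using K(1) by (simp add: mult.commute)
        qed
      qed
      then show ?thesis by (subst (asm) eventually_sequentially_Suc)
    qed
    show "0 \<in> {0..1::real}" by simp
    show "(\<lambda>n. u n 0) sums y 0" by (rule ysums) simp
  qed
  then obtain g where g: "\<And>t. t \<in> {0..1} \<Longrightarrow> (\<lambda>n. u n t) sums (g t)"
    "\<And>t. t \<in> {0..1} \<Longrightarrow> (g has_derivative (\<lambda>h. h *\<^sub>R A t (y t))) (at t within {0..1})" by blast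
  have gy: "g t = y t" if "t \<in> {0..1}" for t using sums_unique2[OF g(1) ysums] that by blast
  show thesis
  proof
    have "u n 0 = (if n = 0 then y0 else 0)" for n by (cases n) (auto simp: u0 uS)
    then have "(\<lambda>n. u n 0) sums y0" using sums_single[of 0 "\<lambda>_. y0"] by simp
    then show "g 0 = y0" using g(1)[of 0] sums_unique2 by fastforce
    show "(g has_vector_derivative A t (g t)) (at t within {0..1})" if "t \<in> {0..1}" for t
      using g(2)[OF that] gy[OF that] by (simp add: has_vector_derivative_def)
  qed
qed

text \<open>The energy \<open>u t \<bullet> u t + e\<^sup>2\<close>, damped at rate
  \<open>2 * K + 1\<close>, is nonincreasing. Squaring avoids differentiating the norm at 0. The
  extra 1 in the rate absorbs the forcing through
  \<open>2 * e * norm (u t) \<le> e\<^sup>2 + (norm (u t))\<^sup>2\<close> and becomes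
  \<open>1 / 2\<close> after taking the root.\<close>

lemma gronwall_zero:
  fixes u :: "real \<Rightarrow> 'e::real_inner"
  assumes u: "\<And>t. t \<in> {0..1} \<Longrightarrow> (u has_vector_derivative u' t) (at t within {0..1})"
    and u0: "u 0 = 0" and e: "e \<ge> 0" and K: "K \<ge> 0"
    and b: "\<And>t. t \<in> {0..1} \<Longrightarrow> norm (u' t) \<le> K * norm (u t) + e"
  shows "norm (u 1) \<le> e * exp (K + 1 / 2)"
proof -
  define f where "f t = (u t \<bullet> u t + e\<^sup>2) * exp (- (2 * K + 1) * t)" for t
  have "f 1 \<le> f 0"
  proof (rule DERIV_nonpos_imp_decreasing_open[of 0 1 f])
    have "continuous_on {0..1} u" using u by (rule continuous_on_vector_derivative)
    then show "continuous_on {0..1} f" unfolding f_def by (intro continuous_intros)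
    fix t :: real assume t: "0 < t" "t < 1"
    have du: "(u has_vector_derivative u' t) (at t)"
      using u[of t] t by (simp add: at_within_Icc_at)
    have "((\<lambda>t. u t \<bullet> u t) has_vector_derivative (u t \<bullet> u' t + u' t \<bullet> u t)) (at t)"
      by (rule bounded_bilinear.has_vector_derivative[OF bounded_bilinear_inner du du])
    then have "((\<lambda>t. u t \<bullet> u t) has_real_derivative (2 * (u t \<bullet> u' t))) (at t)"
      by (simp add: has_real_derivative_iff_has_vector_derivative inner_commute)
    then have D: "(f has_real_derivative
        (2 * (u t \<bullet> u' t) - (2 * K + 1) * (u t \<bullet> u t + e\<^sup>2)) * exp (- (2 * K + 1) * t)) (at t)"
      unfolding f_def by (auto intro!: derivative_eq_intros simp: algebra_simps)
    have "u t \<bullet> u' t \<le> norm (u t) * norm (u' t)" by (rule norm_cauchy_schwarz)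
    also have "\<dots> \<le> norm (u t) * (K * norm (u t) + e)"
      using b[of t] t by (intro mult_left_mono) auto
    finally have "2 * (u t \<bullet> u' t) \<le> 2 * K * (norm (u t))\<^sup>2 + 2 * e * norm (u t)"
      by (simp add: algebra_simps power2_eq_square)
    also have "2 * e * norm (u t) \<le> e\<^sup>2 + (norm (u t))\<^sup>2"
      using sum_squares_bound[of e "norm (u t)"] by simp
    finally have "2 * (u t \<bullet> u' t) \<le> (2 * K + 1) * (u t \<bullet> u t) + e\<^sup>2"
      by (simp add: algebra_simps power2_norm_eq_inner)
    moreover have "0 \<le> K * e\<^sup>2" using K by simp
    ultimately have "2 * (u t \<bullet> u' t) - (2 * K + 1) * (u t \<bullet> u t + e\<^sup>2) \<le> 0"
      by (simp add: algebra_simps)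
    then show "\<exists>y. (f has_real_derivative y) (at t) \<and> y \<le> 0"
      using D by (intro exI conjI) (auto intro: mult_nonpos_nonneg)
  qed simp
  then have "(u 1 \<bullet> u 1 + e\<^sup>2) * exp (- (2 * K + 1)) \<le> e\<^sup>2" by (simp add: f_def u0)
  then have "u 1 \<bullet> u 1 + e\<^sup>2 \<le> e\<^sup>2 * exp (2 * K + 1)"
    unfolding exp_minus by (simp add: pos_divide_le_eq flip: divide_inverse)
  then have "(norm (u 1))\<^sup>2 \<le> e\<^sup>2 * exp (2 * K + 1)"
    unfolding power2_norm_eq_inner using zero_le_power2[of e] by linarith
  also have "\<dots> = (e * exp (K + 1 / 2))\<^sup>2"
    by (simp add: power_mult_distrib flip: exp_double)
  finally show ?thesis by (rule power2_le_imp_le) (use e in simp)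
qed

text \<open>The mean value inequality bounds the remainder by the oscillation of \<open>f'\<close>
  on a small ball; uniform continuity on a compact neighbourhood of \<open>K\<close> lets one radius
  serve all base points.\<close>

lemma C1_uniform_remainder:
  fixes f :: "'v::euclidean_space \<Rightarrow> 'w::real_normed_vector" and f' :: "'v \<Rightarrow> 'v \<Rightarrow>\<^sub>L 'w"
  assumes "open S" "compact K" "K \<subseteq> S"
    and f: "\<And>x. x \<in> S \<Longrightarrow> (f has_derivative f' x) (at x)"
    and f': "continuous_on S f'" and "e > 0"
  shows "\<exists>d>0. \<forall>x\<in>K. \<forall>y. norm (y - x) < d \<longrightarrow>
      y \<in> S \<and> norm (f y - f x - f' x (y - x)) \<le> e * norm (y - x)"
proof -
  obtain r where r: "r > 0" "(\<Union>x\<in>K. cball x r) \<subseteq> S"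
    using compact_subset_open_imp_cball_epsilon_subset[OF assms(2,1,3)] by blast
  let ?N = "\<Union>x\<in>K. cball x r"
  have "uniformly_continuous_on ?N f'"
    by (intro compact_uniformly_continuous compact_minkowski_sum_cball
          continuous_on_subset[OF f'] r \<open>compact K\<close>)
  then obtain d where d: "d > 0" "\<forall>x\<in>?N. \<forall>y\<in>?N. dist y x < d \<longrightarrow> dist (f' y) (f' x) < e"
    using \<open>e > 0\<close> unfolding uniformly_continuous_on_def by meson
  let ?d = "min d r"
  show ?thesis
  proof (intro exI conjI ballI allI impI)
    show "?d > 0" using d r by simp
    fix x y assume x: "x \<in> K" and y: "norm (y - x) < ?d"
    have "ball x ?d \<subseteq> ?N" using x by auto
    then have zN: "z \<in> ?N" if "z \<in> ball x ?d" for z using that by (rule subsetD)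
    have zS: "z \<in> S" if "z \<in> ball x ?d" for z using r(2) zN[OF that] by (rule subsetD)
    have xb: "x \<in> ball x ?d" using d r by simp
    show "y \<in> S" by (rule zS) (use y in \<open>simp add: dist_norm norm_minus_commute\<close>)
    have "norm (f y - f x - f' x (y - x)) \<le> norm (y - x) * e"
    proof (rule differentiable_bound_linearization[where S = "ball x ?d"])
      show "x + t *\<^sub>R (y - x) \<in> ball x ?d" if "t \<in> {0..1}" for t
      proof -
        have "norm (t *\<^sub>R (y - x)) \<le> norm (y - x)"
          using that by (simp add: mult_left_le_one_le del: scaleR_right_diff_distrib)
        then show ?thesis using y by (simp add: dist_norm)
      qed
      fix z assume z: "z \<in> ball x ?d"
      show "(f has_derivative f' z) (at z within ball x ?d)"
        by (rule has_derivative_at_withinI[OF f[OF zS[OF z]]])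
      have "dist (f' z) (f' x) < e"
        by (rule d(2)[rule_format, OF zN[OF xb] zN[OF z]]) (use z in \<open>simp add: dist_commute\<close>)
      then have "norm (f' z - f' x) \<le> e" by (simp add: dist_norm)
      then show "onorm (blinfun_apply (f' z) - blinfun_apply (f' x)) \<le> e"
        by (simp add: norm_blinfun.rep_eq minus_blinfun.rep_eq fun_diff_def)
    qed (rule xb)
    then show "norm (f y - f x - f' x (y - x)) \<le> e * norm (y - x)" by (simp add: mult.commute)
  qed
qed

section \<open>Parallel sections on star-shaped domains\<close>

lemma has_vector_derivative_along_ray:
  fixes f :: "'v::real_normed_vector \<Rightarrow> 'w::real_normed_vector"
  assumes "(f has_derivative f') (at (t *\<^sub>R p))"
  shows "((\<lambda>t. f (t *\<^sub>R p)) has_vector_derivative f' p) (at t within T)"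
proof -
  have "((\<lambda>t. t *\<^sub>R p) has_derivative (\<lambda>h. h *\<^sub>R p)) (at t within T)"
    by (auto intro!: derivative_eq_intros)
  from has_derivative_compose[OF this assms] show ?thesis
    using bounded_linear.linear[OF has_derivative_bounded_linear[OF assms]]
    by (simp add: has_vector_derivative_def linear_cmul)
qed

text \<open>On the ray from 0 to \<open>p\<close> the equation is a linear ODE with zero initial
  value, so the Gronwall bound with \<open>e = 0\<close> applies.\<close>

lemma flat_connection_unique:
  fixes M :: "'v::euclidean_space \<Rightarrow> 'v \<Rightarrow>\<^sub>L 'e \<Rightarrow>\<^sub>L 'e::real_inner"
  assumes star: "\<And>t. t \<in> {0..1} \<Longrightarrow> t *\<^sub>R p \<in> S"
    and M: "continuous_on S M"
    and u: "\<And>x. x \<in> S \<Longrightarrow> (u has_derivative (\<lambda>h. M x h (u x))) (at x)" and u0: "u 0 = 0"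
  shows "u p = 0"
proof -
  have "continuous_on {0..1} (\<lambda>t. M (t *\<^sub>R p) p)"
    by (intro continuous_intros continuous_on_compose2[OF M]) (use star in auto)
  from compact_imp_bounded[OF compact_continuous_image[OF this compact_Icc]]
  obtain K where K: "K > 0" "\<And>t. t \<in> {0..1} \<Longrightarrow> norm (M (t *\<^sub>R p) p) \<le> K"
    unfolding bounded_pos by (metis imageI)
  have "norm (u (1 *\<^sub>R p)) \<le> 0 * exp (K + 1 / 2)"
  proof (rule gronwall_zero[where u = "\<lambda>t. u (t *\<^sub>R p)"])
    fix t :: real assume t: "t \<in> {0..1}"
    show "((\<lambda>t. u (t *\<^sub>R p)) has_vector_derivative M (t *\<^sub>R p) p (u (t *\<^sub>R p))) (at t within {0..1})"
      by (rule has_vector_derivative_along_ray[OF u[OF star[OF t]]])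
    have "norm (M (t *\<^sub>R p) p (u (t *\<^sub>R p))) \<le> norm (M (t *\<^sub>R p) p) * norm (u (t *\<^sub>R p))"
      by (rule norm_blinfun)
    also have "\<dots> \<le> K * norm (u (t *\<^sub>R p))" using K(2)[OF t] by (intro mult_right_mono) auto
    finally show "norm (M (t *\<^sub>R p) p (u (t *\<^sub>R p))) \<le> K * norm (u (t *\<^sub>R p)) + 0" by simp
  qed (use u0 K in auto)
  then show ?thesis by simp
qed

text \<open>Frobenius theorem for a linear total differential equation. Solving the ODE along each
  ray from 0 gives the candidate \<open>Y p 1\<close>; flatness makes its derivative the prescribed
  one in every direction, not only the radial one.\<close>

lemma flat_connection_parallel_section:
  fixes M :: "'v::euclidean_space \<Rightarrow> 'v \<Rightarrow>\<^sub>L 'e \<Rightarrow>\<^sub>L 'e::{real_inner,banach}"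
    and M' :: "'v \<Rightarrow> 'v \<Rightarrow>\<^sub>L 'v \<Rightarrow>\<^sub>L 'e \<Rightarrow>\<^sub>L 'e"
  assumes "open S" and "0 \<in> S" and star: "\<And>p t. p \<in> S \<Longrightarrow> t \<in> {0..1} \<Longrightarrow> t *\<^sub>R p \<in> S"
    and M: "\<And>p. p \<in> S \<Longrightarrow> (M has_derivative M' p) (at p)" and M': "continuous_on S M'"
    and flat: "\<And>p h k y. p \<in> S \<Longrightarrow> M' p h k y + M p k (M p h y) = M' p k h y + M p h (M p k y)"
  shows "\<exists>y. y 0 = y0 \<and> (\<forall>p\<in>S. (y has_derivative (\<lambda>h. M p h (y p))) (at p))"
proof -
  have cM: "continuous_on S M"
    using M by (meson continuous_at_imp_continuous_on has_derivative_continuous)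
  have "\<exists>y. y 0 = y0 \<and> (\<forall>t\<in>{0..1}. (y has_vector_derivative M (t *\<^sub>R p) p (y t)) (at t within {0..1}))"
    if "p \<in> S" for p
  proof -
    have "continuous_on {0..1} (\<lambda>t. M (t *\<^sub>R p) p)"
      by (intro continuous_intros continuous_on_compose2[OF cM]) (use that star in auto)
    from linear_ode_exists[OF this, of y0] show ?thesis by metis
  qed
  then obtain Y where Y0: "\<And>p. p \<in> S \<Longrightarrow> Y p 0 = y0"
    and Y: "\<And>p t. p \<in> S \<Longrightarrow> t \<in> {0..1} \<Longrightarrow>
      (Y p has_vector_derivative M (t *\<^sub>R p) p (Y p t)) (at t within {0..1})"
    by metis
  have deriv: "((\<lambda>q. Y q 1) has_derivative (\<lambda>h. M p h (Y p 1))) (at p)" if p: "p \<in> S" for p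
  proof -
    define Q where "Q = (\<lambda>t. t *\<^sub>R p) ` {0..1}"
    have Q: "compact Q" "Q \<subseteq> S"
      using star[OF p] by (auto simp: Q_def intro!: compact_continuous_image continuous_intros)
    have tQ: "t *\<^sub>R p \<in> Q" if "t \<in> {0..1}" for t using that by (auto simp: Q_def)
    obtain N where N: "N > 0" "\<And>x. x \<in> Q \<Longrightarrow> norm (M x) \<le> N"
      using compact_imp_bounded[OF compact_continuous_image[OF continuous_on_subset[OF cM Q(2)] Q(1)]]
      unfolding bounded_pos by (metis imageI)
    obtain N' where N': "N' > 0" "\<And>x. x \<in> Q \<Longrightarrow> norm (M' x) \<le> N'"
      using compact_imp_bounded[OF compact_continuous_image[OF continuous_on_subset[OF M' Q(2)] Q(1)]]
      unfolding bounded_pos by (metis imageI)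
    have "continuous_on {0..1} (Y p)" using Y[OF p] by (rule continuous_on_vector_derivative)
    from compact_imp_bounded[OF compact_continuous_image[OF this compact_Icc]]
    obtain B where B: "B > 0" "\<And>t. t \<in> {0..1} \<Longrightarrow> norm (Y p t) \<le> B"
      unfolding bounded_pos by (metis imageI)
    \<comment> \<open>\<open>L\<close> is a Lipschitz bound for \<open>M\<close> near
      \<open>Q\<close> (\<open>N'\<close> for the derivative, 1 for the remainder), \<open>C\<close>
      collects the forcing terms quadratic in \<open>h\<close>, \<open>K\<close> bounds
      \<open>M (t *\<^sub>R q) q\<close> when \<open>norm h \<le> 1\<close>, and \<open>E\<close> is
      the Gronwall factor.\<close>
    define L where "L = N' + 1"
    define C where "C = L * B + ((N + L) + L * norm p) * (N * B)"
    define K where "K = (N + L) * (norm p + 1)"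
    define E where "E = exp (K + 1 / 2)"
    have pos: "L > 0" "C \<ge> 0" "K \<ge> 0" "E > 0"
      using N N' B by (auto simp: L_def C_def K_def E_def)
    \<comment> \<open>The remainder constant is 1 whatever \<open>e\<close> is: \<open>e1\<close> is
      chosen below in terms of \<open>E\<close>, so \<open>L\<close> must not depend on it.\<close>
    obtain d1 where d1: "d1 > 0" "\<And>x y. x \<in> Q \<Longrightarrow> norm (y - x) < d1 \<Longrightarrow> y \<in> S"
      "\<And>x y. x \<in> Q \<Longrightarrow> norm (y - x) < d1 \<Longrightarrow> norm (M y - M x - M' x (y - x)) \<le> 1 * norm (y - x)"
      using C1_uniform_remainder[OF \<open>open S\<close> Q M M' zero_less_one] by meson
    show ?thesis
      unfolding has_derivative_at_alt
    proof (intro conjI allI impI)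
      show "bounded_linear (\<lambda>h. M p h (Y p 1))"
        by (intro blinfun.bounded_linear_left bounded_linear_compose[OF blinfun.bounded_linear_left]
            blinfun.bounded_linear_right)
      fix e :: real assume e: "e > 0"
      \<comment> \<open>Half of \<open>e\<close> is reserved for the Taylor remainder, whose share
        after Gronwall is \<open>e1 * (norm p * B) * E\<close>. The added 1 keeps the divisor
        positive when \<open>p = 0\<close>.\<close>
      define e1 where "e1 = e / (2 * (norm p * B + 1) * E)"
      have e1: "e1 > 0" using e B pos by (auto simp: e1_def intro!: divide_pos_pos mult_pos_pos add_nonneg_pos)
      obtain d2 where d2: "d2 > 0" "\<And>x y. x \<in> Q \<Longrightarrow> norm (y - x) < d2 \<Longrightarrow> y \<in> S"
        "\<And>x y. x \<in> Q \<Longrightarrow> norm (y - x) < d2 \<Longrightarrow> norm (M y - M x - M' x (y - x)) \<le> e1 * norm (y - x)"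
        using C1_uniform_remainder[OF \<open>open S\<close> Q M M' e1] by meson
      \<comment> \<open>The four bounds give \<open>norm h \<le> 1\<close>, the two remainder
        estimates, and the other half of \<open>e\<close> for the quadratic share
        \<open>C * norm h * E\<close>.\<close>
      define d where "d = Min {1, d1, d2, e / (2 * (C + 1) * E)}"
      have d: "d > 0" "d \<le> 1" "d \<le> d1" "d \<le> d2" "d \<le> e / (2 * (C + 1) * E)"
        using e pos d1(1) d2(1) by (auto simp: d_def intro!: divide_pos_pos mult_pos_pos)
      show "\<exists>d>0. \<forall>q. norm (q - p) < d \<longrightarrow> norm (Y q 1 - Y p 1 - M p (q - p) (Y p 1)) \<le> e * norm (q - p)"
      proof (intro exI conjI allI impI)
        show "d > 0" by fact
        fix q assume q: "norm (q - p) < d"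
        define h where "h = q - p"
        have h: "norm h < d" "norm h \<le> 1" using q d by (auto simp: h_def)
        have qS: "q \<in> S" using d1(2)[of p q] tQ[of 1] q d by auto
        \<comment> \<open>\<open>W\<close> is the expected derivative of \<open>Y\<close> in direction \<open>h\<close>; flatness says that it solves
          the linearised equation, so that \<open>D\<close> satisfies a Gronwall inequality with small forcing \<open>G\<close>.\<close>
        define W where "W t = t *\<^sub>R M (t *\<^sub>R p) h (Y p t)" for t
        define D where "D t = Y q t - Y p t - W t" for t
        define G where "G t = (M (t *\<^sub>R q) q - M (t *\<^sub>R p) p - M (t *\<^sub>R p) h - t *\<^sub>R M' (t *\<^sub>R p) h p) (Y p t)
            + (M (t *\<^sub>R q) q - M (t *\<^sub>R p) p) (W t)" for t
        have D: "(D has_vector_derivative (M (t *\<^sub>R q) q (D t) + G t)) (at t within {0..1})"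
          if t: "t \<in> {0..1}" for t
        proof -
          have tp: "t *\<^sub>R p \<in> S" using star p t by blast
          have "((\<lambda>t. M (t *\<^sub>R p)) has_vector_derivative M' (t *\<^sub>R p) p) (at t within {0..1})"
            by (rule has_vector_derivative_along_ray[OF M[OF tp]])
          then have "((\<lambda>t. M (t *\<^sub>R p) h) has_vector_derivative M' (t *\<^sub>R p) p h) (at t within {0..1})"
            by (rule bounded_linear.has_vector_derivative[OF blinfun.bounded_linear_left])
          from bounded_bilinear.has_vector_derivative[OF bounded_bilinear_blinfun_apply this Y[OF p t]]
          have "((\<lambda>t. M (t *\<^sub>R p) h (Y p t)) has_vector_derivative
             M (t *\<^sub>R p) h (M (t *\<^sub>R p) p (Y p t)) + M' (t *\<^sub>R p) p h (Y p t)) (at t within {0..1})" .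
          then have "(W has_vector_derivative (t *\<^sub>R (M (t *\<^sub>R p) h (M (t *\<^sub>R p) p (Y p t)) + M' (t *\<^sub>R p) p h (Y p t))
              + 1 *\<^sub>R M (t *\<^sub>R p) h (Y p t))) (at t within {0..1})"
            unfolding W_def by (intro has_vector_derivative_scaleR DERIV_ident)
          then have "(D has_vector_derivative (M (t *\<^sub>R q) q (Y q t) - M (t *\<^sub>R p) p (Y p t) -
               (t *\<^sub>R (M (t *\<^sub>R p) h (M (t *\<^sub>R p) p (Y p t)) + M' (t *\<^sub>R p) p h (Y p t))
              + 1 *\<^sub>R M (t *\<^sub>R p) h (Y p t)))) (at t within {0..1})"
            unfolding D_def by (intro has_vector_derivative_diff Y t p qS)
          \<comment> \<open>Flatness swaps the arguments of \<open>M'\<close>: the derivative of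
            \<open>M\<close> along the ray becomes its derivative towards \<open>h\<close>.\<close>
          also have "M (t *\<^sub>R p) h (M (t *\<^sub>R p) p (Y p t)) + M' (t *\<^sub>R p) p h (Y p t) =
              M' (t *\<^sub>R p) h p (Y p t) + M (t *\<^sub>R p) p (M (t *\<^sub>R p) h (Y p t))"
            using flat[OF tp, of p h] by (simp add: add.commute)
          finally show ?thesis
            by (rule has_vector_derivative_eq_rhs)
              (simp add: D_def G_def W_def blinfun.bilinear_simps algebra_simps)
        qed
        have diff: "norm (M (t *\<^sub>R q) - M (t *\<^sub>R p)) \<le> L * norm h"
          and rem: "norm (M (t *\<^sub>R q) - M (t *\<^sub>R p) - t *\<^sub>R M' (t *\<^sub>R p) h) \<le> e1 * norm h"
          if t: "t \<in> {0..1}" for t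
        proof -
          have eq: "t *\<^sub>R q - t *\<^sub>R p = t *\<^sub>R h" by (simp add: h_def scaleR_right_diff_distrib)
          have le: "norm (t *\<^sub>R h) \<le> norm h" using t by (simp add: mult_left_le_one_le)
          have lt: "norm (t *\<^sub>R q - t *\<^sub>R p) < d" unfolding eq using le h(1) by (rule le_less_trans)
          have "norm (M (t *\<^sub>R q) - M (t *\<^sub>R p) - M' (t *\<^sub>R p) (t *\<^sub>R h)) \<le> e1 * norm (t *\<^sub>R h)"
            using d2(3)[OF tQ[OF t] less_le_trans[OF lt d(4)]] unfolding eq .
          also have "\<dots> \<le> e1 * norm h" using e1 le by (intro mult_left_mono) auto
          finally show "norm (M (t *\<^sub>R q) - M (t *\<^sub>R p) - t *\<^sub>R M' (t *\<^sub>R p) h) \<le> e1 * norm h"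
            by (simp add: blinfun.scaleR_right)
          have "norm (M (t *\<^sub>R q) - M (t *\<^sub>R p) - M' (t *\<^sub>R p) (t *\<^sub>R h)) \<le> 1 * norm (t *\<^sub>R h)"
            using d1(3)[OF tQ[OF t] less_le_trans[OF lt d(3)]] unfolding eq .
          moreover have "norm (M' (t *\<^sub>R p) (t *\<^sub>R h)) \<le> N' * norm (t *\<^sub>R h)"
            by (rule order_trans[OF norm_blinfun mult_right_mono[OF N'(2)[OF tQ[OF t]]]]) simp
          ultimately have "norm (M (t *\<^sub>R q) - M (t *\<^sub>R p)) \<le> L * norm (t *\<^sub>R h)"
            using norm_triangle_sub[of "M (t *\<^sub>R q) - M (t *\<^sub>R p)" "M' (t *\<^sub>R p) (t *\<^sub>R h)"]
            unfolding L_def by (simp only: distrib_right)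
          also have "\<dots> \<le> L * norm h" using pos le by (intro mult_left_mono) auto
          finally show "norm (M (t *\<^sub>R q) - M (t *\<^sub>R p)) \<le> L * norm h" .
        qed
        have Mq: "norm (M (t *\<^sub>R q)) \<le> N + L" if t: "t \<in> {0..1}" for t
        proof -
          have "norm (M (t *\<^sub>R q)) \<le> norm (M (t *\<^sub>R p)) + norm (M (t *\<^sub>R q) - M (t *\<^sub>R p))"
            by (rule norm_triangle_sub)
          also have "\<dots> \<le> N + L * 1"
            by (intro add_mono N tQ t order_trans[OF diff mult_left_mono]) (use pos h in auto)
          finally show ?thesis by simp
        qed
        \<comment> \<open>Only the remainder \<open>?R\<close> applied to \<open>p\<close> is of
          size \<open>e1 * norm h\<close>; all other terms of \<open>G\<close> are quadratic in
          \<open>h\<close>, because \<open>W\<close> and \<open>?d\<close> are both linearly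
          small.\<close>
        have G: "norm (G t) \<le> (e1 * (norm p * B) + C * norm h) * norm h" if t: "t \<in> {0..1}" for t
        proof -
          let ?R = "M (t *\<^sub>R q) - M (t *\<^sub>R p) - t *\<^sub>R M' (t *\<^sub>R p) h" and ?d = "M (t *\<^sub>R q) - M (t *\<^sub>R p)"
          have qp: "q = p + h" by (simp add: h_def)
          have "M (t *\<^sub>R q) q - M (t *\<^sub>R p) p - M (t *\<^sub>R p) h - t *\<^sub>R M' (t *\<^sub>R p) h p = ?d h + ?R p"
            unfolding qp by (simp add: blinfun.bilinear_simps algebra_simps)
          also have "norm \<dots> \<le> L * norm h * norm h + e1 * norm h * norm p"
            by (intro order_trans[OF norm_triangle_ineq] add_mono order_trans[OF norm_blinfun] mult_right_mono diff rem t)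
              auto
          finally have 1: "norm (M (t *\<^sub>R q) q - M (t *\<^sub>R p) p - M (t *\<^sub>R p) h - t *\<^sub>R M' (t *\<^sub>R p) h p)
             \<le> L * norm h * norm h + e1 * norm h * norm p" .
          have "M (t *\<^sub>R q) q - M (t *\<^sub>R p) p = M (t *\<^sub>R q) h + ?d p"
            unfolding qp by (simp add: blinfun.bilinear_simps algebra_simps)
          also have "norm \<dots> \<le> (N + L) * norm h + L * norm h * norm p"
            by (intro order_trans[OF norm_triangle_ineq] add_mono order_trans[OF norm_blinfun] mult_right_mono diff Mq t)
              auto
          finally have 2: "norm (M (t *\<^sub>R q) q - M (t *\<^sub>R p) p) \<le> (N + L) * norm h + L * norm h * norm p" .
          have "norm (M (t *\<^sub>R p) h (Y p t)) \<le> (N * norm h) * B"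
            by (intro order_trans[OF norm_blinfun] mult_mono order_trans[OF norm_blinfun mult_right_mono] N B tQ t)
              (use N in auto)
          moreover have "norm (W t) \<le> norm (M (t *\<^sub>R p) h (Y p t))"
            using t by (simp add: W_def mult_left_le_one_le)
          ultimately have 3: "norm (W t) \<le> N * norm h * B" by simp
          have "norm (G t) \<le> (L * norm h * norm h + e1 * norm h * norm p) * B
              + ((N + L) * norm h + L * norm h * norm p) * (N * norm h * B)"
            unfolding G_def
            by (intro order_trans[OF norm_triangle_ineq] add_mono order_trans[OF norm_blinfun] mult_mono 1 2 3 B t)
              (use pos N e1 in auto)
          also have "\<dots> = (e1 * (norm p * B) + C * norm h) * norm h"
            by (simp add: C_def algebra_simps)
          finally show ?thesis .
        qed
        have "norm (D 1) \<le> (e1 * (norm p * B) + C * norm h) * norm h * E"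
          unfolding E_def
        proof (rule gronwall_zero[OF D])
          show "D 0 = 0" by (simp add: D_def W_def Y0 p qS)
          show "0 \<le> (e1 * (norm p * B) + C * norm h) * norm h" "0 \<le> K" using pos e1 B by auto
          fix t :: real assume t: "t \<in> {0..1}"
          have "norm q \<le> norm p + 1" using norm_triangle_sub[of q p] h unfolding h_def by linarith
          then have "norm (M (t *\<^sub>R q) q) \<le> K"
            unfolding K_def by (intro order_trans[OF norm_blinfun] mult_mono Mq t) (use N pos in auto)
          then have "norm (M (t *\<^sub>R q) q (D t)) \<le> K * norm (D t)"
            by (rule order_trans[OF norm_blinfun mult_right_mono]) auto
          then show "norm (M (t *\<^sub>R q) q (D t) + G t) \<le> K * norm (D t) + (e1 * (norm p * B) + C * norm h) * norm h"
            using G[OF t] by (rule order_trans[OF norm_triangle_ineq add_mono])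
        qed
        also have "\<dots> = ((e1 * (norm p * B)) * E + C * norm h * E) * norm h"
          by (simp add: algebra_simps)
        also have "\<dots> \<le> (e / 2 + e / 2) * norm h"
        proof (intro mult_right_mono add_mono)
          have cancel: "e / (2 * x * E) * x * E = e / 2" if "x > 0" for x
            using that pos(4) by simp
          have "e1 * (norm p * B) * E \<le> e1 * (norm p * B + 1) * E"
            using e1 pos(4) by (intro mult_right_mono mult_left_mono) auto
          also have "\<dots> = e / 2"
            unfolding e1_def by (rule cancel) (use B in \<open>auto intro: add_nonneg_pos\<close>)
          finally show "e1 * (norm p * B) * E \<le> e / 2" .
          have "norm h \<le> e / (2 * (C + 1) * E)" using h(1) d(5) by linarith
          then have "norm h * C * E \<le> e / (2 * (C + 1) * E) * (C + 1) * E"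
            using pos order_trans[OF norm_ge_zero] by (intro mult_right_mono[of _ _ E] mult_mono) auto
          also have "\<dots> = e / 2" by (rule cancel) (use pos(2) in simp)
          finally show "C * norm h * E \<le> e / 2" unfolding mult.commute[of C] .
        qed auto
        finally show "norm (Y q 1 - Y p 1 - M p (q - p) (Y p 1)) \<le> e * norm (q - p)"
          by (simp add: D_def W_def h_def)
      qed
    qed
  qed
  \<comment> \<open>The ray to the origin is constant: the form is evaluated on the vector 0, so
    \<open>Y 0\<close> keeps its initial value.\<close>
  have "\<exists>c. \<forall>t\<in>{0..1}. Y 0 t = c"
  proof (rule has_derivative_zero_constant)
    fix t :: real assume "t \<in> {0..1}"
    from Y[OF \<open>0 \<in> S\<close> this] show "(Y 0 has_derivative (\<lambda>h. 0)) (at t within {0..1})"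
      by (simp add: has_vector_derivative_def)
  qed simp
  then obtain c where c: "\<And>t. t \<in> {0..1} \<Longrightarrow> Y 0 t = c" by blast
  have "Y 0 1 = y0" using c[of 0] c[of 1] Y0[OF \<open>0 \<in> S\<close>] by simp
  with deriv show ?thesis by (intro exI[of _ "\<lambda>q. Y q 1"]) simp
qed

section \<open>The frame system of a minimal surface\<close>

lemma has_vector_derivative_along_line:
  assumes "(f has_derivative D) (at (z::complex))"
  shows "((\<lambda>t. f (z + complex_of_real t * n)) has_vector_derivative D n) (at 0)"
proof -
  have "((\<lambda>t. z + complex_of_real t * n) has_derivative (\<lambda>h. complex_of_real h * n)) (at 0)"
    by (auto intro!: derivative_eq_intros)
  moreover have "(f has_derivative D) (at (z + complex_of_real 0 * n))" using assms by simp
  ultimately have "((\<lambda>t. f (z + complex_of_real t * n)) has_derivative (\<lambda>h. D (complex_of_real h * n))) (at 0)"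
    by (rule has_derivative_compose)
  moreover have "D (complex_of_real h * n) = h *\<^sub>R D n" for h
    using linear_cmul[OF has_derivative_linear[OF assms], of h n] by (simp add: scaleR_conv_of_real)
  ultimately show ?thesis by (simp add: has_vector_derivative_def)
qed

lemma has_derivative_imp_partials:
  assumes "(f has_derivative D) (at z)"
  shows "pdx f z = D 1" "pdy f z = D \<i>"
  unfolding pdx_def pdy_def
  using has_vector_derivative_along_line[OF assms, of 1] has_vector_derivative_along_line[OF assms, of \<i>]
  by (auto intro!: vector_derivative_at simp: mult.commute)

lemma has_derivative_imp_dirderiv:
  assumes "(f has_derivative D) (at z)"
  shows "dirderiv f z n = D n"
  unfolding dirderiv_def by (rule vector_derivative_at[OF has_vector_derivative_along_line[OF assms]])

lemma differentiable_imp_has_derivative_partials: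
  assumes "f differentiable at z"
  shows "(f has_derivative (\<lambda>h. Re h *\<^sub>R pdx f z + Im h *\<^sub>R pdy f z)) (at z)"
proof -
  obtain D where D: "(f has_derivative D) (at z)" using assms unfolding differentiable_def by blast
  have Dh: "D h = Re h *\<^sub>R D 1 + Im h *\<^sub>R D \<i>" for h
  proof -
    have "h = Re h *\<^sub>R 1 + Im h *\<^sub>R \<i>" by (simp add: complex_eq_iff)
    then have "D h = D (Re h *\<^sub>R 1 + Im h *\<^sub>R \<i>)" by simp
    also have "\<dots> = Re h *\<^sub>R D 1 + Im h *\<^sub>R D \<i>"
      using has_derivative_linear[OF D] by (simp add: linear_add linear_cmul del: scaleR_conv_of_real)
    finally show ?thesis .
  qed
  have "D = (\<lambda>h. Re h *\<^sub>R pdx f z + Im h *\<^sub>R pdy f z)"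
    unfolding has_derivative_imp_partials[OF D] by (rule ext) (rule Dh)
  with D show ?thesis by simp
qed

section \<open>The connection form of the frame system\<close>

type_synonym frame = "(real^3) \<times> (real^3) \<times> (real^3) \<times> (real^3)"

text \<open>The form \<open>A ds + B dt\<close>; the coefficients are numbers for differentials of
  functions and operators for connection forms.\<close>

definition one_form :: "'a::real_normed_vector \<Rightarrow> 'a \<Rightarrow> complex \<Rightarrow>\<^sub>L 'a" where
  "one_form A B = (blinfun_scaleR_left A o\<^sub>L Blinfun Re) + (blinfun_scaleR_left B o\<^sub>L Blinfun Im)"

lemma one_form_apply [simp]: "one_form A B h = Re h *\<^sub>R A + Im h *\<^sub>R B"
  by (simp add: one_form_def blinfun.add_left bounded_linear_Blinfun_apply bounded_linear_Re bounded_linear_Im)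

lemma continuous_on_one_form [continuous_intros]:
  assumes "continuous_on S A" "continuous_on S B"
  shows "continuous_on S (\<lambda>x. one_form (A x) (B x))"
  unfolding one_form_def
  by (intro continuous_intros bounded_linear.continuous_on[OF bounded_linear_blinfun_scaleR_left]
      bounded_bilinear.continuous_on[OF bounded_bilinear_blinfun_compose] assms)

text \<open>A \<open>frame\<close> lists e1, e2, the normal and the position. The constant
  generators are rotation of the tangent plane, bending with opposite signs in the two coordinate
  directions, and motion of the position along e1 or e2.\<close>

definition frame_rot :: "frame \<Rightarrow>\<^sub>L frame" where
  "frame_rot = Blinfun (\<lambda>(a, b, n, x). (- b, a, 0, 0))"
definition frame_curv_s :: "frame \<Rightarrow>\<^sub>L frame" where
  "frame_curv_s = Blinfun (\<lambda>(a, b, n, x). (n, 0, - a, 0))"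
definition frame_curv_t :: "frame \<Rightarrow>\<^sub>L frame" where
  "frame_curv_t = Blinfun (\<lambda>(a, b, n, x). (0, - n, b, 0))"
definition frame_step_s :: "frame \<Rightarrow>\<^sub>L frame" where
  "frame_step_s = Blinfun (\<lambda>(a, b, n, x). (0, 0, 0, a))"
definition frame_step_t :: "frame \<Rightarrow>\<^sub>L frame" where
  "frame_step_t = Blinfun (\<lambda>(a, b, n, x). (0, 0, 0, b))"

lemma frame_maps_apply [simp]:
  "frame_rot (a, b, n, x) = (- b, a, 0, 0)"
  "frame_curv_s (a, b, n, x) = (n, 0, - a, 0)"
  "frame_curv_t (a, b, n, x) = (0, - n, b, 0)"
  "frame_step_s (a, b, n, x) = (0, 0, 0, a)"
  "frame_step_t (a, b, n, x) = (0, 0, 0, b)"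
  unfolding frame_rot_def frame_curv_s_def frame_curv_t_def frame_step_s_def frame_step_t_def
  by (subst bounded_linear_Blinfun_apply;
      auto intro!: linear_conv_bounded_linear[THEN iffD1] linearI)+

text \<open>\<open>k\<close> scales the second fundamental form, \<open>q ds - p dt\<close> is the
  Levi-Civita part when \<open>p\<close>, \<open>q\<close> are the partial derivatives of
  \<open>w\<close>, and \<open>l\<close> is the conformal factor. All variation sits in scalar
  coefficients of constant operators.\<close>

definition frame_form :: "real \<Rightarrow> real \<Rightarrow> real \<Rightarrow> real \<Rightarrow> complex \<Rightarrow>\<^sub>L frame \<Rightarrow>\<^sub>L frame" where
  "frame_form k p q l = k *\<^sub>R one_form frame_curv_s frame_curv_t + p *\<^sub>R one_form 0 (- frame_rot)
     + q *\<^sub>R one_form frame_rot 0 + l *\<^sub>R one_form frame_step_s frame_step_t"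

lemma frame_form_apply:
  "frame_form k p q l h (a, b, n, x) =
     (Re h *\<^sub>R (k *\<^sub>R n - q *\<^sub>R b) + Im h *\<^sub>R (p *\<^sub>R b),
      Re h *\<^sub>R (q *\<^sub>R a) - Im h *\<^sub>R (p *\<^sub>R a + k *\<^sub>R n),
      Im h *\<^sub>R (k *\<^sub>R b) - Re h *\<^sub>R (k *\<^sub>R a),
      Re h *\<^sub>R (l *\<^sub>R a) + Im h *\<^sub>R (l *\<^sub>R b))"
  by (simp add: frame_form_def blinfun.bilinear_simps algebra_simps)

text \<open>The data of a minimal surface in conformal curvature line coordinates: \<open>w\<close> is the logarithm of the
  conformal factor, the second fundamental form is \<open>c (ds\<^sup>2 - dt\<^sup>2)\<close>, and \<open>gauss\<close> is the Gauss equation.\<close>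

locale minimal_surface_data =
  fixes S :: "complex set" and w ws wt wss wst wts wtt :: "complex \<Rightarrow> real" and c :: real
  assumes open_S: "open S" and convex_S: "convex S" and zero_S: "0 \<in> S"
    and w: "\<And>\<xi>. \<xi> \<in> S \<Longrightarrow> (w has_derivative (\<lambda>h. Re h * ws \<xi> + Im h * wt \<xi>)) (at \<xi>)"
    and ws: "\<And>\<xi>. \<xi> \<in> S \<Longrightarrow> (ws has_derivative (\<lambda>h. Re h * wss \<xi> + Im h * wst \<xi>)) (at \<xi>)"
    and wt: "\<And>\<xi>. \<xi> \<in> S \<Longrightarrow> (wt has_derivative (\<lambda>h. Re h * wts \<xi> + Im h * wtt \<xi>)) (at \<xi>)"
    and cont: "continuous_on S wss" "continuous_on S wst" "continuous_on S wts" "continuous_on S wtt"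
    and gauss: "\<And>\<xi>. \<xi> \<in> S \<Longrightarrow> wss \<xi> + wtt \<xi> = c\<^sup>2 * exp (- 2 * w \<xi>)"
begin

text \<open>Gauss-Weingarten equations in the unit frame instead of the coordinate fields: the
  second fundamental form enters with coefficient \<open>c * exp (- w \<xi>)\<close>, and the part
  acting on the frame vectors is skew.\<close>

definition frame_equations ::
  "(complex \<Rightarrow> real^3) \<Rightarrow> (complex \<Rightarrow> real^3) \<Rightarrow> (complex \<Rightarrow> real^3) \<Rightarrow> (complex \<Rightarrow> real^3) \<Rightarrow> bool" where
  "frame_equations e1 e2 n X \<longleftrightarrow> (\<forall>\<xi>\<in>S.
     (e1 has_derivative (\<lambda>h. Re h *\<^sub>R ((c * exp (- w \<xi>)) *\<^sub>R n \<xi> - wt \<xi> *\<^sub>R e2 \<xi>) + Im h *\<^sub>R (ws \<xi> *\<^sub>R e2 \<xi>))) (at \<xi>) \<and>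
     (e2 has_derivative (\<lambda>h. Re h *\<^sub>R (wt \<xi> *\<^sub>R e1 \<xi>) - Im h *\<^sub>R (ws \<xi> *\<^sub>R e1 \<xi> + (c * exp (- w \<xi>)) *\<^sub>R n \<xi>))) (at \<xi>) \<and>
     (n has_derivative (\<lambda>h. Im h *\<^sub>R ((c * exp (- w \<xi>)) *\<^sub>R e2 \<xi>) - Re h *\<^sub>R ((c * exp (- w \<xi>)) *\<^sub>R e1 \<xi>))) (at \<xi>) \<and>
     (X has_derivative (\<lambda>h. Re h *\<^sub>R (exp (w \<xi>) *\<^sub>R e1 \<xi>) + Im h *\<^sub>R (exp (w \<xi>) *\<^sub>R e2 \<xi>))) (at \<xi>))"

definition form :: "complex \<Rightarrow> complex \<Rightarrow>\<^sub>L frame \<Rightarrow>\<^sub>L frame" where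
  "form \<xi> = frame_form (c * exp (- w \<xi>)) (ws \<xi>) (wt \<xi>) (exp (w \<xi>))"

lemma star_S: "p \<in> S \<Longrightarrow> t \<in> {0..1} \<Longrightarrow> t *\<^sub>R p \<in> S"
  using convexD[OF convex_S _ zero_S, of p t "1 - t"] by simp

lemma continuous_data: "continuous_on S w" "continuous_on S ws" "continuous_on S wt"
  using w ws wt by (meson continuous_at_imp_continuous_on has_derivative_continuous)+

lemma continuous_form: "continuous_on S form"
  unfolding form_def frame_form_def by (intro continuous_intros continuous_data)

lemma frame_equations_iff:
  "frame_equations e1 e2 n X \<longleftrightarrow>
    (\<forall>\<xi>\<in>S. ((\<lambda>\<xi>. (e1 \<xi>, e2 \<xi>, n \<xi>, X \<xi>)) has_derivative (\<lambda>h. form \<xi> h (e1 \<xi>, e2 \<xi>, n \<xi>, X \<xi>))) (at \<xi>))"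
  (is "_ \<longleftrightarrow> (\<forall>\<xi>\<in>S. (?y has_derivative ?D \<xi>) (at \<xi>))")
proof
  assume "frame_equations e1 e2 n X"
  then show "\<forall>\<xi>\<in>S. (?y has_derivative ?D \<xi>) (at \<xi>)"
    unfolding frame_equations_def form_def frame_form_apply by (auto intro!: has_derivative_Pair)
next
  assume *: "\<forall>\<xi>\<in>S. (?y has_derivative ?D \<xi>) (at \<xi>)"
  show "frame_equations e1 e2 n X"
    unfolding frame_equations_def
  proof
    fix \<xi> assume "\<xi> \<in> S"
    with * have y: "(?y has_derivative ?D \<xi>) (at \<xi>)" by blast
    note y2 = has_derivative_snd[OF y]
    note y3 = has_derivative_snd[OF y2]
    show "(e1 has_derivative (\<lambda>h. Re h *\<^sub>R ((c * exp (- w \<xi>)) *\<^sub>R n \<xi> - wt \<xi> *\<^sub>R e2 \<xi>) + Im h *\<^sub>R (ws \<xi> *\<^sub>R e2 \<xi>))) (at \<xi>) \<and>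
     (e2 has_derivative (\<lambda>h. Re h *\<^sub>R (wt \<xi> *\<^sub>R e1 \<xi>) - Im h *\<^sub>R (ws \<xi> *\<^sub>R e1 \<xi> + (c * exp (- w \<xi>)) *\<^sub>R n \<xi>))) (at \<xi>) \<and>
     (n has_derivative (\<lambda>h. Im h *\<^sub>R ((c * exp (- w \<xi>)) *\<^sub>R e2 \<xi>) - Re h *\<^sub>R ((c * exp (- w \<xi>)) *\<^sub>R e1 \<xi>))) (at \<xi>) \<and>
     (X has_derivative (\<lambda>h. Re h *\<^sub>R (exp (w \<xi>) *\<^sub>R e1 \<xi>) + Im h *\<^sub>R (exp (w \<xi>) *\<^sub>R e2 \<xi>))) (at \<xi>)"
      using has_derivative_fst[OF y] has_derivative_fst[OF y2] has_derivative_fst[OF y3] has_derivative_snd[OF y3]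
      by (simp only: form_def frame_form_apply fst_conv snd_conv simp_thms)
  qed
qed

text \<open>By linearity, the difference of two solutions is a parallel section vanishing at
  0.\<close>

lemma frame_unique:
  assumes f: "frame_equations e1 e2 n X" and g: "frame_equations f1 f2 m Y"
    and eq: "e1 0 = f1 0" "e2 0 = f2 0" "n 0 = m 0" "X 0 = Y 0" and "\<xi> \<in> S"
  shows "X \<xi> = Y \<xi>"
proof -
  let ?u = "\<lambda>\<xi>. (e1 \<xi>, e2 \<xi>, n \<xi>, X \<xi>) - (f1 \<xi>, f2 \<xi>, m \<xi>, Y \<xi>)"
  have "?u \<xi> = 0"
  proof (rule flat_connection_unique[where M = form and S = S])
    show "(?u has_derivative (\<lambda>h. form x h (?u x))) (at x)" if "x \<in> S" for x
      using has_derivative_diff[OF f[unfolded frame_equations_iff, rule_format, OF that]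
        g[unfolded frame_equations_iff, rule_format, OF that]]
      by (simp only: blinfun.diff_right)
    show "?u 0 = 0" using eq by (simp add: zero_prod_def)
  qed (use star_S continuous_form \<open>\<xi> \<in> S\<close> in auto)
  then show ?thesis by (simp add: zero_prod_def)
qed

text \<open>Flatness of \<open>form\<close> amounts to the Gauss equation: the Codazzi equations
  hold because \<open>c\<close> is constant, and the position component is closed because the
  tangential rotation is the Levi-Civita connection.\<close>

lemma frame_exists:
  obtains e1 e2 n X where "frame_equations e1 e2 n X"
    "e1 0 = axis 1 1" "e2 0 = axis 2 1" "n 0 = axis 3 1" "X 0 = 0"
proof -
  define k where "k \<xi> = c * exp (- w \<xi>)" for \<xi>
  define dk where "dk \<xi> = one_form (- k \<xi> * ws \<xi>) (- k \<xi> * wt \<xi>)" for \<xi>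
  define dp where "dp \<xi> = one_form (wss \<xi>) (wst \<xi>)" for \<xi>
  define dq where "dq \<xi> = one_form (wts \<xi>) (wtt \<xi>)" for \<xi>
  define dl where "dl \<xi> = one_form (exp (w \<xi>) * ws \<xi>) (exp (w \<xi>) * wt \<xi>)" for \<xi>
  \<comment> \<open>Only the scalar coefficients of \<open>form\<close> vary, so its derivative
    carries their differentials in the same places.\<close>
  define M' where "M' \<xi> = (blinfun_scaleR_left (one_form frame_curv_s frame_curv_t) o\<^sub>L dk \<xi>)
     + (blinfun_scaleR_left (one_form 0 (- frame_rot)) o\<^sub>L dp \<xi>)
     + (blinfun_scaleR_left (one_form frame_rot 0) o\<^sub>L dq \<xi>)
     + (blinfun_scaleR_left (one_form frame_step_s frame_step_t) o\<^sub>L dl \<xi>)" for \<xi>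
  have M'_apply: "M' \<xi> h = frame_form (dk \<xi> h) (dp \<xi> h) (dq \<xi> h) (dl \<xi> h)" for \<xi> h
    by (simp add: M'_def frame_form_def blinfun.add_left)
  have dk: "(k has_derivative dk \<xi>) (at \<xi>)" if "\<xi> \<in> S" for \<xi>
    unfolding k_def dk_def by (auto intro!: derivative_eq_intros w[OF that] simp: algebra_simps)
  have dl: "((\<lambda>\<xi>. exp (w \<xi>)) has_derivative dl \<xi>) (at \<xi>)" if "\<xi> \<in> S" for \<xi>
    unfolding dl_def by (auto intro!: derivative_eq_intros w[OF that] simp: algebra_simps)
  have dp: "(ws has_derivative dp \<xi>) (at \<xi>)" if "\<xi> \<in> S" for \<xi>
    unfolding dp_def using ws[OF that] by (simp add: one_form_apply[abs_def])
  have dq: "(wt has_derivative dq \<xi>) (at \<xi>)" if "\<xi> \<in> S" for \<xi>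
    unfolding dq_def using wt[OF that] by (simp add: one_form_apply[abs_def])
  have form_k: "form = (\<lambda>\<xi>. frame_form (k \<xi>) (ws \<xi>) (wt \<xi>) (exp (w \<xi>)))"
    by (simp add: form_def k_def fun_eq_iff)
  have deriv: "(form has_derivative M' \<xi>) (at \<xi>)" if "\<xi> \<in> S" for \<xi>
  proof -
    have "(form has_derivative (\<lambda>h. frame_form (dk \<xi> h) (dp \<xi> h) (dq \<xi> h) (dl \<xi> h))) (at \<xi>)"
      unfolding form_k frame_form_def
      by (intro has_derivative_add bounded_linear.has_derivative[OF bounded_linear_scaleR_left]
          dk dp dq dl that)
    then show ?thesis by (simp add: M'_apply[abs_def])
  qed
  have cM': "continuous_on S M'"
    unfolding M'_def dk_def dp_def dq_def dl_def k_def
    by (intro continuous_intros continuous_data cont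
        bounded_bilinear.continuous_on[OF bounded_bilinear_blinfun_compose])
  have flat: "M' \<xi> h j y + form \<xi> j (form \<xi> h y) = M' \<xi> j h y + form \<xi> h (form \<xi> j y)" if "\<xi> \<in> S" for \<xi> h j y
  proof -
    obtain a b n x where y: "y = (a, b, n, x)" by (cases y)
    \<comment> \<open>The Gauss equation in terms of \<open>k\<close>. Eliminating
      \<open>wtt\<close> turns flatness into a polynomial identity.\<close>
    have "k \<xi> * k \<xi> = wss \<xi> + wtt \<xi>"
      unfolding gauss[OF that] by (simp add: k_def power2_eq_square flip: exp_add)
    then have wtt: "wtt \<xi> = k \<xi> * k \<xi> - wss \<xi>" by simp
    show ?thesis
      unfolding M'_apply form_k y frame_form_apply
      by (simp add: dk_def dp_def dq_def dl_def wtt algebra_simps)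
  qed
  from flat_connection_parallel_section[OF open_S zero_S star_S deriv cM' flat]
  obtain y where y: "y 0 = (axis 1 1, axis 2 1, axis 3 1, 0)"
      "\<forall>p\<in>S. (y has_derivative (\<lambda>h. form p h (y p))) (at p)"
    by blast
  show thesis
  proof
    show "frame_equations (\<lambda>\<xi>. fst (y \<xi>)) (\<lambda>\<xi>. fst (snd (y \<xi>))) (\<lambda>\<xi>. fst (snd (snd (y \<xi>))))
       (\<lambda>\<xi>. snd (snd (snd (y \<xi>))))"
      unfolding frame_equations_iff using y(2) by simp
  qed (simp_all add: y(1))
qed

end

text \<open>\<open>vector\<close> lists rows, so the transpose puts the frame into the
  columns.\<close>

definition frame_matrix :: "real^3 \<Rightarrow> real^3 \<Rightarrow> real^3 \<Rightarrow> real^3^3" where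
  "frame_matrix a b n = transpose (vector [a, b, n])"

lemma frame_matrix_axis:
  "frame_matrix a b n *v axis 1 1 = a" "frame_matrix a b n *v axis 2 1 = b" "frame_matrix a b n *v axis 3 1 = n"
  unfolding matrix_vector_mult_basis
  by (simp_all add: vec_eq_iff frame_matrix_def column_def transpose_def vector_3)

section \<open>Geometry of the integrated surface\<close>

context minimal_surface_data
begin

lemma frame_equationsD:
  assumes "frame_equations e1 e2 n X" "\<xi> \<in> S"
  shows "(e1 has_derivative (\<lambda>h. Re h *\<^sub>R ((c * exp (- w \<xi>)) *\<^sub>R n \<xi> - wt \<xi> *\<^sub>R e2 \<xi>) + Im h *\<^sub>R (ws \<xi> *\<^sub>R e2 \<xi>))) (at \<xi>)"
    "(e2 has_derivative (\<lambda>h. Re h *\<^sub>R (wt \<xi> *\<^sub>R e1 \<xi>) - Im h *\<^sub>R (ws \<xi> *\<^sub>R e1 \<xi> + (c * exp (- w \<xi>)) *\<^sub>R n \<xi>))) (at \<xi>)"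
    "(n has_derivative (\<lambda>h. Im h *\<^sub>R ((c * exp (- w \<xi>)) *\<^sub>R e2 \<xi>) - Re h *\<^sub>R ((c * exp (- w \<xi>)) *\<^sub>R e1 \<xi>))) (at \<xi>)"
    "(X has_derivative (\<lambda>h. Re h *\<^sub>R (exp (w \<xi>) *\<^sub>R e1 \<xi>) + Im h *\<^sub>R (exp (w \<xi>) *\<^sub>R e2 \<xi>))) (at \<xi>)"
  using assms unfolding frame_equations_def by blast+

lemma constant_on_S:
  fixes f :: "complex \<Rightarrow> real"
  assumes "\<And>\<xi>. \<xi> \<in> S \<Longrightarrow> (f has_derivative (\<lambda>h. 0)) (at \<xi>)" "\<xi> \<in> S"
  shows "f \<xi> = f 0"
proof -
  have "\<exists>a. \<forall>x\<in>S. f x = a"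
    by (rule has_derivative_zero_constant[OF convex_S has_derivative_at_withinI[OF assms(1)]])
  then show ?thesis using assms(2) zero_S by metis
qed

text \<open>The frame matrix satisfies \<open>dF = F \<Omega>\<close> with \<open>\<Omega>\<close>
  skew, so \<open>F F\<^sup>T\<close> and the determinant keep their values at 0.\<close>

lemma frame_rotation:
  assumes fr: "frame_equations e1 e2 n X"
    and init: "e1 0 = axis 1 1" "e2 0 = axis 2 1" "n 0 = axis 3 1" and \<xi>: "\<xi> \<in> S"
  shows "rotation_matrix (frame_matrix (e1 \<xi>) (e2 \<xi>) (n \<xi>))"
proof -
  let ?V = "vector [e1 \<xi>, e2 \<xi>, n \<xi>] :: real^3^3"
  have comp: "((\<lambda>\<xi>. e1 \<xi> $ i) has_derivative (\<lambda>h. Re h * (c * exp (- w \<xi>) * n \<xi> $ i - wt \<xi> * e2 \<xi> $ i) + Im h * (ws \<xi> * e2 \<xi> $ i))) (at \<xi>)"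
    "((\<lambda>\<xi>. e2 \<xi> $ i) has_derivative (\<lambda>h. Re h * (wt \<xi> * e1 \<xi> $ i) - Im h * (ws \<xi> * e1 \<xi> $ i + c * exp (- w \<xi>) * n \<xi> $ i))) (at \<xi>)"
    "((\<lambda>\<xi>. n \<xi> $ i) has_derivative (\<lambda>h. Im h * (c * exp (- w \<xi>) * e2 \<xi> $ i) - Re h * (c * exp (- w \<xi>) * e1 \<xi> $ i))) (at \<xi>)"
    if "\<xi> \<in> S" for \<xi> i
    using frame_equationsD(1-3)[OF fr that, THEN bounded_linear.has_derivative[OF bounded_linear_vec_nth[of i]]]
    by (simp_all add: mult.assoc)
  \<comment> \<open>Components \<open>i\<close>, \<open>j\<close> are fixed and the sum runs over
    the three frame vectors: its derivative cancels outright, whereas inner products of frame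
    vectors only satisfy a coupled linear system.\<close>
  have gram: "e1 \<xi> $ i * e1 \<xi> $ j + e2 \<xi> $ i * e2 \<xi> $ j + n \<xi> $ i * n \<xi> $ j =
      e1 0 $ i * e1 0 $ j + e2 0 $ i * e2 0 $ j + n 0 $ i * n 0 $ j" for i j
    by (rule constant_on_S[OF _ \<xi>])
      (auto intro!: derivative_eq_intros comp simp: algebra_simps)
  have "transpose ?V ** ?V = mat 1"
    using gram unfolding init
    by (simp add: vec_eq_iff forall_3 matrix_matrix_mult_def transpose_def sum_3 vector_3 mat_def axis_def)
  then have "orthogonal_matrix ?V" by (simp add: orthogonal_matrix)
  \<comment> \<open>A skew form has trace zero, so the determinant is constant too; the value 1
    excludes reflections.\<close>
  moreover have "det ?V = det (vector [e1 0, e2 0, n 0] :: real^3^3)"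
    unfolding det_3 vector_3
    by (rule constant_on_S[OF _ \<xi>])
      (auto intro!: derivative_eq_intros comp simp: algebra_simps)
  then have "det ?V = 1" unfolding init by (simp add: det_3 vector_3 axis_def)
  ultimately show ?thesis
    by (simp add: rotation_matrix_def frame_matrix_def det_transpose orthogonal_matrix_transpose)
qed

lemma frame_orthonormal:
  assumes fr: "frame_equations e1 e2 n X"
    and init: "e1 0 = axis 1 1" "e2 0 = axis 2 1" "n 0 = axis 3 1" and \<xi>: "\<xi> \<in> S"
  shows "e1 \<xi> \<bullet> e1 \<xi> = 1" "e2 \<xi> \<bullet> e2 \<xi> = 1" "e1 \<xi> \<bullet> e2 \<xi> = 0"
proof -
  have "transpose (frame_matrix (e1 \<xi>) (e2 \<xi>) (n \<xi>)) ** frame_matrix (e1 \<xi>) (e2 \<xi>) (n \<xi>) = mat 1"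
    using frame_rotation[OF assms] by (simp add: rotation_matrix_def orthogonal_matrix)
  then have "(e1 \<xi> \<bullet> e1 \<xi> = 1 \<and> e2 \<xi> \<bullet> e2 \<xi> = 1) \<and> e1 \<xi> \<bullet> e2 \<xi> = 0"
    by (simp add: frame_matrix_def vec_eq_iff forall_3 matrix_matrix_mult_def transpose_def sum_3
        vector_3 mat_def inner_vec_def)
  then show "e1 \<xi> \<bullet> e1 \<xi> = 1" "e2 \<xi> \<bullet> e2 \<xi> = 1" "e1 \<xi> \<bullet> e2 \<xi> = 0" by auto
qed

lemma frame_partials:
  assumes "frame_equations e1 e2 n X" "\<xi> \<in> S"
  shows "pdx X \<xi> = exp (w \<xi>) *\<^sub>R e1 \<xi>" "pdy X \<xi> = exp (w \<xi>) *\<^sub>R e2 \<xi>"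
  using has_derivative_imp_partials[OF frame_equationsD(4)[OF assms]] by simp_all

lemma surf_normal_tangent:
  assumes "frame_equations e1 e2 n X" "\<xi> \<in> S"
  shows "surf_normal X \<xi> \<bullet> e2 \<xi> = 0"
  by (simp add: surf_normal_def Let_def frame_partials[OF assms] cross_mult_left cross_mult_right dot_cross_self)

text \<open>In the normal part \<open>exp (w \<xi>)\<close> cancels \<open>exp (- w \<xi>)\<close>
  and leaves the constant \<open>c\<close>. The two pure second derivatives come out opposite, so
  \<open>X\<close> is harmonic.\<close>

lemma frame_second_derivatives:
  assumes fr: "frame_equations e1 e2 n X" and \<xi>: "\<xi> \<in> S"
  shows "(pdx X has_derivative (\<lambda>h.
            Re h *\<^sub>R (exp (w \<xi>) *\<^sub>R (ws \<xi> *\<^sub>R e1 \<xi> - wt \<xi> *\<^sub>R e2 \<xi>) + c *\<^sub>R n \<xi>) +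
            Im h *\<^sub>R (exp (w \<xi>) *\<^sub>R (wt \<xi> *\<^sub>R e1 \<xi> + ws \<xi> *\<^sub>R e2 \<xi>)))) (at \<xi>)" (is "(_ has_derivative ?Dx) _")
    and "(pdy X has_derivative (\<lambda>h.
            Re h *\<^sub>R (exp (w \<xi>) *\<^sub>R (wt \<xi> *\<^sub>R e1 \<xi> + ws \<xi> *\<^sub>R e2 \<xi>)) -
            Im h *\<^sub>R (exp (w \<xi>) *\<^sub>R (ws \<xi> *\<^sub>R e1 \<xi> - wt \<xi> *\<^sub>R e2 \<xi>) + c *\<^sub>R n \<xi>))) (at \<xi>)" (is "(_ has_derivative ?Dy) _")
proof -
  have L: "((\<lambda>\<xi>. exp (w \<xi>)) has_derivative (\<lambda>h. exp (w \<xi>) * (Re h * ws \<xi> + Im h * wt \<xi>))) (at \<xi>)"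
    by (auto intro!: derivative_eq_intros w[OF \<xi>])
  have k: "exp (w \<xi>) * exp (- w \<xi>) = 1" "exp (w \<xi>) * (exp (- w \<xi>) * x) = x" for x
    by (simp_all add: exp_minus)
  have "((\<lambda>\<xi>. exp (w \<xi>) *\<^sub>R e1 \<xi>) has_derivative ?Dx) (at \<xi>)"
    by (rule has_derivative_eq_rhs[OF has_derivative_scaleR[OF L frame_equationsD(1)[OF fr \<xi>]]])
      (simp add: fun_eq_iff algebra_simps k)
  then show "(pdx X has_derivative ?Dx) (at \<xi>)"
    by (rule has_derivative_transform_within_open[OF _ open_S \<xi>]) (simp add: frame_partials[OF fr])
  have "((\<lambda>\<xi>. exp (w \<xi>) *\<^sub>R e2 \<xi>) has_derivative ?Dy) (at \<xi>)"
    by (rule has_derivative_eq_rhs[OF has_derivative_scaleR[OF L frame_equationsD(2)[OF fr \<xi>]]])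
      (simp add: fun_eq_iff algebra_simps k)
  then show "(pdy X has_derivative ?Dy) (at \<xi>)"
    by (rule has_derivative_transform_within_open[OF _ open_S \<xi>]) (simp add: frame_partials[OF fr])
qed

lemma frame_minimal:
  assumes fr: "frame_equations e1 e2 n X"
    and init: "e1 0 = axis 1 1" "e2 0 = axis 2 1" "n 0 = axis 3 1"
  shows "minimal_immersion_on S X" and "conformal_factor_on S X (\<lambda>\<xi>. exp (w \<xi>))"
proof -
  note on = frame_orthonormal[OF fr init]
  note d2 = frame_second_derivatives[OF fr]
  have xx: "pdx (pdx X) \<xi> = exp (w \<xi>) *\<^sub>R (ws \<xi> *\<^sub>R e1 \<xi> - wt \<xi> *\<^sub>R e2 \<xi>) + c *\<^sub>R n \<xi>"
    and xy: "pdy (pdx X) \<xi> = exp (w \<xi>) *\<^sub>R (wt \<xi> *\<^sub>R e1 \<xi> + ws \<xi> *\<^sub>R e2 \<xi>)"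
    and yx: "pdx (pdy X) \<xi> = exp (w \<xi>) *\<^sub>R (wt \<xi> *\<^sub>R e1 \<xi> + ws \<xi> *\<^sub>R e2 \<xi>)"
    and yy: "pdy (pdy X) \<xi> = - (exp (w \<xi>) *\<^sub>R (ws \<xi> *\<^sub>R e1 \<xi> - wt \<xi> *\<^sub>R e2 \<xi>) + c *\<^sub>R n \<xi>)"
    if "\<xi> \<in> S" for \<xi>
    using has_derivative_imp_partials[OF d2(1)[OF that]] has_derivative_imp_partials[OF d2(2)[OF that]]
    by simp_all
  have ce: "continuous_on S e1" "continuous_on S e2" "continuous_on S n"
    using frame_equationsD(1-3)[OF fr]
    by (meson continuous_at_imp_continuous_on has_derivative_continuous)+
  have "C2_on S X"
    unfolding C2_on_def
  proof (intro conjI ballI)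
    show "open S" by (rule open_S)
    show "continuous_on S (pdx (pdx X))"
      by (subst continuous_on_cong[OF refl xx]) (auto intro!: continuous_intros continuous_data ce)
    show "continuous_on S (pdx (pdy X))"
      by (subst continuous_on_cong[OF refl yx]) (auto intro!: continuous_intros continuous_data ce)
    show "continuous_on S (pdy (pdx X))"
      by (subst continuous_on_cong[OF refl xy]) (auto intro!: continuous_intros continuous_data ce)
    show "continuous_on S (pdy (pdy X))"
      by (subst continuous_on_cong[OF refl yy]) (auto intro!: continuous_intros continuous_data ce)
  qed (use frame_equationsD(4)[OF fr] d2 in \<open>blast intro: differentiableI\<close>)+
  moreover have "cross3 (pdx X \<xi>) (pdy X \<xi>) \<noteq> 0" if "\<xi> \<in> S" for \<xi>
  proof -
    have "cross3 (e1 \<xi>) (e2 \<xi>) \<noteq> 0"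
      using norm_and_cross_eq_0[of "e1 \<xi>" "e2 \<xi>"] on[OF that] by auto
    then show ?thesis by (simp add: frame_partials[OF fr that] cross_mult_left cross_mult_right)
  qed
  moreover have "mean_curvature X \<xi> = 0" if "\<xi> \<in> S" for \<xi>
  proof -
    \<comment> \<open>Harmonicity with \<open>E = G\<close> and \<open>F = 0\<close> makes the
      numerator of the mean curvature vanish for either choice of normal, without relating
      \<open>surf_normal\<close> to \<open>n\<close>.\<close>
    have "pdy (pdy X) \<xi> = - pdx (pdx X) \<xi>" using xx[OF that] yy[OF that] by simp
    then show ?thesis
      by (simp add: mean_curvature_def Let_def frame_partials[OF fr that] on[OF that])
  qed
  ultimately show "minimal_immersion_on S X"
    by (simp add: minimal_immersion_on_def immersion_on_def)
  show "conformal_factor_on S X (\<lambda>\<xi>. exp (w \<xi>))"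
    using on by (simp add: conformal_factor_on_def frame_partials[OF fr] power2_eq_square)
qed

text \<open>Along a coordinate line with \<open>wt = \<plusminus>exp w\<close> the point \<open>X \<minusplus> e2\<close> is stationary; it is the centre of the sphere.\<close>

lemma frame_meets_sphere:
  assumes fr: "frame_equations e1 e2 n X"
    and init: "e1 0 = axis 1 1" "e2 0 = axis 2 1" "n 0 = axis 3 1"
    and line: "{\<xi>. Im \<xi> = t0} \<subseteq> S"
    and \<sigma>: "\<sigma> * \<sigma> = 1" and bc: "\<And>\<xi>. Im \<xi> = t0 \<Longrightarrow> wt \<xi> = \<sigma> * exp (w \<xi>)"
  shows "\<exists>a. meets_orthogonally_along a X {\<xi>. Im \<xi> = t0}"
proof -
  define Z where "Z \<xi> = X \<xi> - \<sigma> *\<^sub>R e2 \<xi>" for \<xi>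
  define l where "l s = of_real s + \<i> * of_real t0" for s
  have lS: "l s \<in> S" for s using line by (auto simp: l_def)
  have "\<exists>a. \<forall>s\<in>UNIV. Z (l s) = a"
  proof (rule has_derivative_zero_constant)
    fix s :: real
    have "(l has_derivative of_real) (at s)"
      unfolding l_def by (auto intro!: derivative_eq_intros)
    moreover have "(Z has_derivative (\<lambda>h. (Re h *\<^sub>R (exp (w (l s)) *\<^sub>R e1 (l s)) + Im h *\<^sub>R (exp (w (l s)) *\<^sub>R e2 (l s)))
        - \<sigma> *\<^sub>R (Re h *\<^sub>R (wt (l s) *\<^sub>R e1 (l s)) - Im h *\<^sub>R (ws (l s) *\<^sub>R e1 (l s) + (c * exp (- w (l s))) *\<^sub>R n (l s))))) (at (l s))"
      unfolding Z_def
      by (intro has_derivative_diff has_derivative_scaleR_right frame_equationsD[OF fr lS])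
    ultimately have D: "((\<lambda>s. Z (l s)) has_derivative (\<lambda>h. h *\<^sub>R (exp (w (l s)) *\<^sub>R e1 (l s))
        - \<sigma> *\<^sub>R h *\<^sub>R (wt (l s) *\<^sub>R e1 (l s)))) (at s)"
      by (rule has_derivative_eq_rhs[OF has_derivative_compose]) simp
    \<comment> \<open>By the boundary condition, the derivative of \<open>Z\<close> along the line
      is \<open>exp (w (l s)) * (1 - \<sigma> * \<sigma>)\<close> times \<open>e1\<close>, which is
      0.\<close>
    have "wt (l s) = \<sigma> * exp (w (l s))" by (rule bc) (simp add: l_def)
    then have "h *\<^sub>R (exp (w (l s)) *\<^sub>R e1 (l s)) - \<sigma> *\<^sub>R h *\<^sub>R (wt (l s) *\<^sub>R e1 (l s))
        = (h * exp (w (l s)) * (1 - \<sigma> * \<sigma>)) *\<^sub>R e1 (l s)" for h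
      by (simp add: algebra_simps)
    then have "h *\<^sub>R (exp (w (l s)) *\<^sub>R e1 (l s)) - \<sigma> *\<^sub>R h *\<^sub>R (wt (l s) *\<^sub>R e1 (l s)) = 0" for h
      unfolding \<sigma> by (metis diff_self mult_zero_right scaleR_zero_left)
    with D show "((\<lambda>s. Z (l s)) has_derivative (\<lambda>h. 0)) (at s within UNIV)" by (simp only:)
  qed simp
  then obtain a where a: "\<And>s. Z (l s) = a" by blast
  have "X \<xi> \<in> sphere a 1 \<and> surf_normal X \<xi> \<bullet> (X \<xi> - a) = 0" if "Im \<xi> = t0" for \<xi>
  proof -
    have \<xi>: "\<xi> \<in> S" using that line by auto
    have "l (Re \<xi>) = \<xi>" using that by (simp add: l_def complex_eq_iff)
    \<comment> \<open>The radius vector is a unit tangent vector of the surface; this gives both the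
      sphere and the right angle.\<close>
    then have Xa: "X \<xi> - a = \<sigma> *\<^sub>R e2 \<xi>" using a[of "Re \<xi>"] by (simp add: Z_def algebra_simps)
    have "\<bar>\<sigma>\<bar> = 1" using \<sigma> by (metis abs_1 abs_mult abs_mult_self_eq abs_square_eq_1 power2_eq_square)
    moreover have "norm (e2 \<xi>) = 1" using frame_orthonormal(2)[OF fr init \<xi>] by (simp add: norm_eq_sqrt_inner)
    ultimately have "norm (X \<xi> - a) = 1" unfolding Xa by simp
    then have "X \<xi> \<in> sphere a 1" by (simp add: dist_norm norm_minus_commute)
    then show ?thesis unfolding Xa using surf_normal_tangent[OF fr \<xi>] by simp
  qed
  then show ?thesis unfolding meets_orthogonally_along_def by blast
qed

text \<open>Shifting the parameter by a period and applying a rigid motion both preserve the frame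
  equations. The motion is chosen to match the two solutions at 0, and uniqueness identifies
  them.\<close>

lemma frame_period:
  assumes fr: "frame_equations e1 e2 n X"
    and init: "e1 0 = axis 1 1" "e2 0 = axis 2 1" "n 0 = axis 3 1" "X 0 = 0"
    and per: "\<And>\<xi>. \<xi> \<in> S \<Longrightarrow> \<xi> + p \<in> S" "\<And>\<xi>. w (\<xi> + p) = w \<xi>" "\<And>\<xi>. ws (\<xi> + p) = ws \<xi>" "\<And>\<xi>. wt (\<xi> + p) = wt \<xi>"
  shows "\<exists>A b. rotation_matrix A \<and> (\<forall>\<xi>\<in>S. X (\<xi> + p) = A *v X \<xi> + b)"
proof -
  \<comment> \<open>This rotation carries the standard basis, which is the frame at 0, to the frame
    at \<open>p\<close>; the translation will be \<open>X p\<close>.\<close>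
  let ?A = "frame_matrix (e1 p) (e2 p) (n p)"
  have pS: "p \<in> S" using per(1)[OF zero_S] by simp
  have shift: "((\<lambda>\<xi>. f (\<xi> + p)) has_derivative D) (at \<xi>)" if "(f has_derivative D) (at (\<xi> + p))"
    for f :: "complex \<Rightarrow> real^3" and D \<xi>
  proof -
    have "((\<lambda>\<xi>. \<xi> + p) has_derivative (\<lambda>h. h)) (at \<xi>)" by (auto intro!: derivative_eq_intros)
    from has_derivative_compose[OF this that] show ?thesis .
  qed
  have 1: "frame_equations (\<lambda>\<xi>. e1 (\<xi> + p)) (\<lambda>\<xi>. e2 (\<xi> + p)) (\<lambda>\<xi>. n (\<xi> + p)) (\<lambda>\<xi>. X (\<xi> + p))"
    unfolding frame_equations_def
    using frame_equationsD[OF fr per(1), THEN shift] by (simp only: per simp_thms ball_simps) blast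
  have A: "((\<lambda>\<xi>. ?A *v f \<xi>) has_derivative (\<lambda>h. ?A *v D h)) (at \<xi>)" if "(f has_derivative D) (at \<xi>)" for f D \<xi>
    using that by (rule bounded_linear.has_derivative[OF matrix_vector_mul_bounded_linear])
  have 2: "frame_equations (\<lambda>\<xi>. ?A *v e1 \<xi>) (\<lambda>\<xi>. ?A *v e2 \<xi>) (\<lambda>\<xi>. ?A *v n \<xi>) (\<lambda>\<xi>. ?A *v X \<xi> + X p)"
    unfolding frame_equations_def
    using frame_equationsD[OF fr, THEN A]
    by (auto simp: matrix_vector_right_distrib matrix_vector_mult_diff_distrib matrix_vector_mult_scaleR
        intro!: has_derivative_add_const)
  have "X (\<xi> + p) = ?A *v X \<xi> + X p" if "\<xi> \<in> S" for \<xi>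
    by (rule frame_unique[OF 1 2 _ _ _ _ that]) (simp_all add: init frame_matrix_axis)
  then show ?thesis using frame_rotation[OF fr init(1-3) pS] by blast
qed

end

section \<open>Orbits under integer powers of a bijection\<close>

lemma ipow_orbit:
  fixes X :: "complex \<Rightarrow> 'a"
  assumes "bij T" and T: "\<And>\<xi>. \<xi> \<in> S \<Longrightarrow> T (X \<xi>) = X (\<xi> + p)"
    and S: "\<And>\<xi>. \<xi> \<in> S \<Longrightarrow> \<xi> + p \<in> S" "\<And>\<xi>. \<xi> \<in> S \<Longrightarrow> \<xi> - p \<in> S" and \<xi>: "\<xi> \<in> S"
  shows "ipow T m (X \<xi>) = X (\<xi> + of_int m * p)" and "\<xi> + of_int m * p \<in> S"
proof -
  have f: "(T ^^ j) (X \<xi>) = X (\<xi> + of_nat j * p) \<and> \<xi> + of_nat j * p \<in> S" for j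
  proof (induction j)
    case (Suc j)
    with T[of "\<xi> + of_nat j * p"] S(1)[of "\<xi> + of_nat j * p"] show ?case by (simp add: algebra_simps)
  qed (simp add: \<xi>)
  have inv: "inv T (X \<eta>) = X (\<eta> - p)" if "\<eta> \<in> S" for \<eta>
    using T[OF S(2)[OF that]] inv_f_f[OF bij_is_inj[OF \<open>bij T\<close>], of "X (\<eta> - p)"] by simp
  have g: "(inv T ^^ j) (X \<xi>) = X (\<xi> - of_nat j * p) \<and> \<xi> - of_nat j * p \<in> S" for j
  proof (induction j)
    case (Suc j)
    with inv[of "\<xi> - of_nat j * p"] S(2)[of "\<xi> - of_nat j * p"] show ?case by (simp add: algebra_simps)
  qed (simp add: \<xi>)
  show "ipow T m (X \<xi>) = X (\<xi> + of_int m * p)" and "\<xi> + of_int m * p \<in> S"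
    using f[of "nat m"] g[of "nat (- m)"] by (cases "0 \<le> m"; simp add: ipow_def)+
qed

section \<open>The covering of the annulus\<close>

lemma has_derivative_exp_minus_i:
  "((\<lambda>\<xi>. exp (- \<i> * \<xi>)) has_derivative (\<lambda>h. - \<i> * h * exp (- \<i> * \<xi>))) (at \<xi>)"
proof -
  have "((\<lambda>\<xi>. exp (- \<i> * \<xi>)) has_field_derivative (- \<i> * exp (- \<i> * \<xi>))) (at \<xi>)"
    by (auto intro!: derivative_eq_intros)
  then show ?thesis
    unfolding has_field_derivative_def by (rule has_derivative_eq_rhs) (simp add: fun_eq_iff)
qed

text \<open>Increasing \<open>Re \<xi>\<close> rotates \<open>z\<close> clockwise and increasing
  \<open>Im \<xi>\<close> dilates it, so the two coefficients are the derivatives of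
  \<open>g\<close> along \<open>- \<i> * z\<close> and along \<open>z\<close>.\<close>

lemma has_derivative_exp_cover:
  fixes g :: "complex \<Rightarrow> real"
  assumes "g differentiable at (exp (- \<i> * \<xi>))"
  defines "z \<equiv> exp (- \<i> * \<xi>)"
  shows "((\<lambda>\<xi>. g (exp (- \<i> * \<xi>))) has_derivative
    (\<lambda>h. Re h * (Im z * pdx g z - Re z * pdy g z) + Im h * (Re z * pdx g z + Im z * pdy g z))) (at \<xi>)"
proof -
  from has_derivative_compose[OF has_derivative_exp_minus_i differentiable_imp_has_derivative_partials[OF assms(1)]]
  show ?thesis
    by (rule has_derivative_eq_rhs) (simp add: fun_eq_iff z_def algebra_simps)
qed

lemma exp_cover_periodic: "exp (- \<i> * (\<xi> + 2 * complex_of_real pi)) = exp (- \<i> * \<xi>)"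
proof -
  have "- \<i> * (\<xi> + 2 * complex_of_real pi) = - \<i> * \<xi> - 2 * of_real pi * \<i>" by (simp add: algebra_simps)
  then show ?thesis by (simp add: exp_diff)
qed

lemma orbit_of_fundamental_piece:
  fixes X :: "complex \<Rightarrow> 'a"
  assumes "bij T" and T: "\<And>\<xi>. \<xi> \<in> strip R \<epsilon> \<Longrightarrow> T (X \<xi>) = X (\<xi> + 2 * complex_of_real pi)"
  shows "T ` X ` strip0 R \<epsilon> = X ` ((\<lambda>\<xi>. \<xi> + 2 * complex_of_real pi) ` strip0 R \<epsilon>)"
    and "X ` strip R \<epsilon> = (\<Union>m::int. ipow T m ` X ` strip0 R \<epsilon>)"
proof -
  let ?p = "2 * complex_of_real pi"
  show "T ` X ` strip0 R \<epsilon> = X ` ((\<lambda>\<xi>. \<xi> + ?p) ` strip0 R \<epsilon>)"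
    unfolding image_image by (rule image_cong) (auto simp: strip0_def T)
  have S: "\<xi> + ?p \<in> strip R \<epsilon>" "\<xi> - ?p \<in> strip R \<epsilon>" if "\<xi> \<in> strip R \<epsilon>" for \<xi>
    using that by (auto simp: strip_def)
  have orbit: "ipow T m (X \<xi>) = X (\<xi> + of_int m * ?p)" "\<xi> + of_int m * ?p \<in> strip R \<epsilon>"
    if "\<xi> \<in> strip R \<epsilon>" for m \<xi>
    using ipow_orbit[where T = T and X = X and p = ?p and S = "strip R \<epsilon>"] \<open>bij T\<close> T S that by simp_all
  show "X ` strip R \<epsilon> = (\<Union>m::int. ipow T m ` X ` strip0 R \<epsilon>)"
  proof (intro equalityI subsetI)
    fix x assume "x \<in> X ` strip R \<epsilon>"
    then obtain \<xi> where \<xi>: "\<xi> \<in> strip R \<epsilon>" and x: "x = X \<xi>" by blast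
    \<comment> \<open>Subtracting this many periods moves the real part into the interval of
      \<open>strip0\<close>; the power \<open>m\<close> of \<open>T\<close> undoes the
      shift.\<close>
    define m where "m = \<lfloor>Re \<xi> / (2 * pi)\<rfloor>"
    define \<eta> where "\<eta> = \<xi> - of_int m * ?p"
    have \<eta>S: "\<eta> \<in> strip R \<epsilon>" using \<xi> by (simp add: \<eta>_def strip_def)
    have "of_int m \<le> Re \<xi> / (2 * pi)" "Re \<xi> / (2 * pi) < of_int m + 1"
      unfolding m_def by linarith+
    then have "of_int m * (2 * pi) \<le> Re \<xi>" "Re \<xi> \<le> (of_int m + 1) * (2 * pi)"
      by (simp_all add: field_simps)
    then have "\<eta> \<in> strip0 R \<epsilon>" using \<eta>S by (simp add: strip0_def \<eta>_def algebra_simps)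
    moreover have "x = ipow T m (X \<eta>)"
      unfolding orbit(1)[OF \<eta>S] x by (simp add: \<eta>_def)
    ultimately show "x \<in> (\<Union>m. ipow T m ` X ` strip0 R \<epsilon>)" by blast
  next
    fix x assume "x \<in> (\<Union>m. ipow T m ` X ` strip0 R \<epsilon>)"
    then obtain m \<xi> where \<xi>: "\<xi> \<in> strip R \<epsilon>" and x: "x = ipow T m (X \<xi>)"
      by (auto simp: strip0_def)
    then show "x \<in> X ` strip R \<epsilon>" using orbit[OF \<xi>, of m] by simp
  qed
qed

section \<open>The surface belonging to a solution of the boundary value problem\<close>

theorem theorem5p1:
  fixes R \<epsilon> C\<^sub>0 :: real and v :: "complex \<Rightarrow> real"
  assumes "R > 1" and "0 < \<epsilon>" and "\<epsilon> < 1"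
    and "C2_on (annulus (1 - \<epsilon>) (R + \<epsilon>)) v"
    and "\<forall>z\<in>annulus (1 - \<epsilon>) (R + \<epsilon>). laplacian v z + 2 * C\<^sub>0\<^sup>2 * exp (v z) = 0"
    and "\<forall>z. cmod z = 1 \<longrightarrow> dirderiv v z z = 2 * exp (- v z / 2) - 2"
    and "\<forall>z. cmod z = R \<longrightarrow> dirderiv v z (- z / complex_of_real R) = 2 / R\<^sup>2 * exp (- v z / 2) + 2 / R"
  shows "\<exists>X O\<^sub>1 O\<^sub>2 \<Lambda> T.
     minimal_immersion_on (strip R \<epsilon>) X \<and>
     conformal_factor_on (strip R \<epsilon>) X \<Lambda> \<and>
     (\<forall>\<xi>\<in>strip R \<epsilon>. v (exp (- \<i> * \<xi>)) = ln (1 / ((\<Lambda> \<xi>)\<^sup>2 * (cmod (exp (- \<i> * \<xi>)))\<^sup>2))) \<and>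
     meets_orthogonally_along O\<^sub>1 X {\<xi>. Im \<xi> = 0} \<and>
     meets_orthogonally_along O\<^sub>2 X {\<xi>. Im \<xi> = ln R} \<and>
     rigid_motion T \<and>
     T ` X ` strip0 R \<epsilon> = X ` ((\<lambda>\<xi>. \<xi> + 2 * complex_of_real pi) ` strip0 R \<epsilon>) \<and>
     X ` strip R \<epsilon> = (\<Union>n::int. ipow T n ` X ` strip0 R \<epsilon>)"
proof -
  let ?A = "annulus (1 - \<epsilon>) (R + \<epsilon>)" and ?S = "strip R \<epsilon>"
  define \<phi> :: "complex \<Rightarrow> complex" where "\<phi> \<xi> = exp (- \<i> * \<xi>)" for \<xi>
  have cmod_\<phi>: "cmod (\<phi> \<xi>) = exp (Im \<xi>)" for \<xi> by (simp add: \<phi>_def norm_exp_eq_Re)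
  have \<phi>A: "\<phi> \<xi> \<in> ?A" if "\<xi> \<in> ?S" for \<xi>
  proof -
    have "exp (ln (1 - \<epsilon>)) < exp (Im \<xi>)" "exp (Im \<xi>) < exp (ln (R + \<epsilon>))"
      using that unfolding strip_def by simp_all
    then show ?thesis using assms(1-3) by (simp add: annulus_def cmod_\<phi>)
  qed
  have C2: "v differentiable at z" "pdx v differentiable at z" "pdy v differentiable at z" if "z \<in> ?A" for z
    using assms(4) that by (auto simp: C2_on_def)
  note d\<phi> = has_derivative_exp_cover[folded \<phi>_def]
  have D\<phi>: "(\<phi> has_derivative (\<lambda>h. - \<i> * h * \<phi> \<xi>)) (at \<xi>)" for \<xi>
    unfolding \<phi>_def by (rule has_derivative_exp_minus_i)
  define ds where "ds g \<xi> = Im (\<phi> \<xi>) * pdx g (\<phi> \<xi>) - Re (\<phi> \<xi>) * pdy g (\<phi> \<xi>)" for g and \<xi>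
  define dt where "dt g \<xi> = Re (\<phi> \<xi>) * pdx g (\<phi> \<xi>) + Im (\<phi> \<xi>) * pdy g (\<phi> \<xi>)" for g and \<xi>
  have dg: "((\<lambda>\<xi>. g (\<phi> \<xi>)) has_derivative (\<lambda>h. Re h * ds g \<xi> + Im h * dt g \<xi>)) (at \<xi>)"
    if "g differentiable at (\<phi> \<xi>)" for g \<xi>
    using d\<phi>[OF that] by (simp add: ds_def dt_def)
  \<comment> \<open>Forced by the required metric: since
    \<open>cmod (\<phi> \<xi>) = exp (Im \<xi>)\<close>, a conformal factor
    \<open>exp (w \<xi>)\<close> means
    \<open>v (\<phi> \<xi>) = - 2 * w \<xi> - 2 * Im \<xi>\<close>.\<close>
  define w where "w \<xi> = - v (\<phi> \<xi>) / 2 - Im \<xi>" for \<xi>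
  define ws where "ws \<xi> = - ds v \<xi> / 2" for \<xi>
  define wt where "wt \<xi> = - dt v \<xi> / 2 - 1" for \<xi>
  \<comment> \<open>Product rule for \<open>ds v\<close> and \<open>dt v\<close>. \<open>wst\<close>
    and \<open>wts\<close> are kept apart, so mixed partials of \<open>v\<close> are never
    interchanged.\<close>
  define wss where "wss \<xi> = - (- Re (\<phi> \<xi>) * pdx v (\<phi> \<xi>) + Im (\<phi> \<xi>) * ds (pdx v) \<xi>
     - Im (\<phi> \<xi>) * pdy v (\<phi> \<xi>) - Re (\<phi> \<xi>) * ds (pdy v) \<xi>) / 2" for \<xi>
  define wst where "wst \<xi> = - (Im (\<phi> \<xi>) * pdx v (\<phi> \<xi>) + Im (\<phi> \<xi>) * dt (pdx v) \<xi>
     - Re (\<phi> \<xi>) * pdy v (\<phi> \<xi>) - Re (\<phi> \<xi>) * dt (pdy v) \<xi>) / 2" for \<xi>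
  define wts where "wts \<xi> = - (Im (\<phi> \<xi>) * pdx v (\<phi> \<xi>) + Re (\<phi> \<xi>) * ds (pdx v) \<xi>
     - Re (\<phi> \<xi>) * pdy v (\<phi> \<xi>) + Im (\<phi> \<xi>) * ds (pdy v) \<xi>) / 2" for \<xi>
  define wtt where "wtt \<xi> = - (Re (\<phi> \<xi>) * pdx v (\<phi> \<xi>) + Re (\<phi> \<xi>) * dt (pdx v) \<xi>
     + Im (\<phi> \<xi>) * pdy v (\<phi> \<xi>) + Im (\<phi> \<xi>) * dt (pdy v) \<xi>) / 2" for \<xi>
  have S_eq: "?S = Im -` {ln (1 - \<epsilon>)<..<ln (R + \<epsilon>)}" by (auto simp: strip_def)
  have ln0: "ln (1 - \<epsilon>) < 0" "0 < ln R" "ln R < ln (R + \<epsilon>)" using assms(1-3) by auto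
  have c\<phi>: "continuous_on ?S \<phi>" unfolding \<phi>_def by (intro continuous_intros)
  have c1: "continuous_on ?A (pdx v)" "continuous_on ?A (pdy v)"
    using C2 by (auto intro!: continuous_at_imp_continuous_on differentiable_imp_continuous_within)
  have c2: "continuous_on ?A (pdx (pdx v))" "continuous_on ?A (pdx (pdy v))"
    "continuous_on ?A (pdy (pdx v))" "continuous_on ?A (pdy (pdy v))"
    using assms(4) by (auto simp: C2_on_def)
  have c: "continuous_on ?S (\<lambda>\<xi>. g (\<phi> \<xi>))" if "continuous_on ?A g" for g :: "complex \<Rightarrow> real"
    by (rule continuous_on_compose2[OF that c\<phi>]) (use \<phi>A in auto)
  interpret minimal_surface_data ?S w ws wt wss wst wts wtt C\<^sub>0
  proof
    show "open ?S" unfolding S_eq by (intro open_vimage continuous_intros open_greaterThanLessThan)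
    show "convex ?S" unfolding S_eq
      by (rule convex_linear_vimage) (auto intro: bounded_linear.linear bounded_linear_Im)
    show "0 \<in> ?S" using ln0 by (simp add: strip_def)
    show "continuous_on ?S wss" "continuous_on ?S wst" "continuous_on ?S wts" "continuous_on ?S wtt"
      unfolding wss_def wst_def wts_def wtt_def ds_def dt_def
      by (intro continuous_intros c\<phi> c[OF c1(1)] c[OF c1(2)] c[OF c2(1)] c[OF c2(2)] c[OF c2(3)] c[OF c2(4)]; simp)+
    fix \<xi> assume "\<xi> \<in> ?S"
    note A = \<phi>A[OF this]
    note D = dg[OF C2(1)[OF A]] dg[OF C2(2)[OF A]] dg[OF C2(3)[OF A]] D\<phi>
    show "(w has_derivative (\<lambda>h. Re h * ws \<xi> + Im h * wt \<xi>)) (at \<xi>)"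
      unfolding w_def ws_def wt_def
      by (auto intro!: derivative_eq_intros D simp: algebra_simps)
    show "(ws has_derivative (\<lambda>h. Re h * wss \<xi> + Im h * wst \<xi>)) (at \<xi>)"
      unfolding ws_def wss_def wst_def
      by (subst ds_def[abs_def]) (auto intro!: derivative_eq_intros D simp: fun_eq_iff field_simps)
    show "(wt has_derivative (\<lambda>h. Re h * wts \<xi> + Im h * wtt \<xi>)) (at \<xi>)"
      unfolding wt_def wts_def wtt_def
      by (subst dt_def[abs_def]) (auto intro!: derivative_eq_intros D simp: fun_eq_iff field_simps)
    \<comment> \<open>First-order and mixed terms cancel: in log-polar coordinates the Laplacian is
      the Euclidean one times the squared modulus.\<close>
    have "wss \<xi> + wtt \<xi> = - ((Re (\<phi> \<xi>))\<^sup>2 + (Im (\<phi> \<xi>))\<^sup>2) * laplacian v (\<phi> \<xi>) / 2"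
      by (simp add: wss_def wtt_def ds_def dt_def laplacian_def power2_eq_square field_simps)
    also have "(Re (\<phi> \<xi>))\<^sup>2 + (Im (\<phi> \<xi>))\<^sup>2 = exp (2 * Im \<xi>)"
      using cmod_\<phi>[of \<xi>] by (simp add: exp_double flip: cmod_power2)
    also have "laplacian v (\<phi> \<xi>) = - 2 * C\<^sub>0\<^sup>2 * exp (v (\<phi> \<xi>))" using assms(5) A by force
    also have "- exp (2 * Im \<xi>) * (- 2 * C\<^sub>0\<^sup>2 * exp (v (\<phi> \<xi>))) / 2 = C\<^sub>0\<^sup>2 * exp (- 2 * w \<xi>)"
      by (simp add: w_def exp_add algebra_simps)
    finally show "wss \<xi> + wtt \<xi> = C\<^sub>0\<^sup>2 * exp (- 2 * w \<xi>)" .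
  qed
  obtain e1 e2 n X where fr: "frame_equations e1 e2 n X"
    and init: "e1 0 = axis 1 1" "e2 0 = axis 2 1" "n 0 = axis 3 1" "X 0 = 0"
    by (rule frame_exists)
  have lines: "{\<xi>. Im \<xi> = 0} \<subseteq> ?S" "{\<xi>. Im \<xi> = ln R} \<subseteq> ?S"
    using ln0 by (auto simp: strip_def)
  \<comment> \<open>The inner normals are \<open>z\<close> on the unit circle and
    \<open>- z / R\<close> on the outer one, so both are real multiples of the radial direction,
    whose derivative is \<open>dt v\<close>.\<close>
  have dir: "dirderiv v (\<phi> \<xi>) (of_real a * \<phi> \<xi>) = a * dt v \<xi>" if "\<xi> \<in> ?S" for \<xi> a
    using has_derivative_imp_dirderiv[OF differentiable_imp_has_derivative_partials[OF C2(1)[OF \<phi>A[OF that]]]]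
    by (simp add: dt_def algebra_simps)
  \<comment> \<open>The \<open>- 2\<close> in the boundary condition cancels the \<open>- 1\<close>
    that the term \<open>- Im \<xi>\<close> of \<open>w\<close> contributes to
    \<open>wt\<close>.\<close>
  have bc1: "wt \<xi> = - 1 * exp (w \<xi>)" if "Im \<xi> = 0" for \<xi>
  proof -
    have "dt v \<xi> = 2 * exp (- v (\<phi> \<xi>) / 2) - 2"
      using dir[of \<xi> 1] assms(6)[rule_format, of "\<phi> \<xi>"] lines(1) that by (auto simp: cmod_\<phi>)
    then show ?thesis using that by (simp add: wt_def w_def diff_divide_distrib)
  qed
  have bc2: "wt \<xi> = 1 * exp (w \<xi>)" if "Im \<xi> = ln R" for \<xi>
  proof -
    have "cmod (\<phi> \<xi>) = R" using that assms(1) by (simp add: cmod_\<phi>)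
    then have "dirderiv v (\<phi> \<xi>) (- \<phi> \<xi> / complex_of_real R) = 2 / R\<^sup>2 * exp (- v (\<phi> \<xi>) / 2) + 2 / R"
      using assms(7) by blast
    moreover have "- \<phi> \<xi> / complex_of_real R = of_real (- 1 / R) * \<phi> \<xi>" by simp
    ultimately have "- dt v \<xi> / R = 2 / R\<^sup>2 * exp (- v (\<phi> \<xi>) / 2) + 2 / R"
      using dir[of \<xi> "- 1 / R"] lines(2) that by auto
    \<comment> \<open>Multiplying by \<open>- R\<close> reverses the inner normal; the remaining
      \<open>1 / R\<close> is the factor \<open>exp (- Im \<xi>)\<close> in
      \<open>exp (w \<xi>)\<close>.\<close>
    then have "dt v \<xi> = - 2 * (exp (- v (\<phi> \<xi>) / 2) / R) - 2"
      using assms(1) by (simp add: field_simps power2_eq_square)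
    moreover have "exp (w \<xi>) = exp (- v (\<phi> \<xi>) / 2) / R"
      using that assms(1) by (simp add: w_def exp_diff)
    ultimately show ?thesis by (simp add: wt_def add_divide_distrib diff_divide_distrib)
  qed
  \<comment> \<open>With sign \<open>- 1\<close> the centre is \<open>X + e2\<close>; for the second
    sphere, sign 1 gives \<open>X - e2\<close>.\<close>
  obtain O\<^sub>1 where O1: "meets_orthogonally_along O\<^sub>1 X {\<xi>. Im \<xi> = 0}"
    using frame_meets_sphere[OF fr init(1-3) lines(1), of "- 1"] bc1 by auto
  obtain O\<^sub>2 where O2: "meets_orthogonally_along O\<^sub>2 X {\<xi>. Im \<xi> = ln R}"
    using frame_meets_sphere[OF fr init(1-3) lines(2), of 1] bc2 by auto
  \<comment> \<open>The data see \<open>\<xi>\<close> only through \<open>\<phi> \<xi>\<close> and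
    \<open>Im \<xi>\<close>, both unchanged by the shift.\<close>
  have \<phi>_per: "\<phi> (\<xi> + 2 * complex_of_real pi) = \<phi> \<xi>" for \<xi>
    unfolding \<phi>_def by (rule exp_cover_periodic)
  have "\<exists>A b. rotation_matrix A \<and> (\<forall>\<xi>\<in>?S. X (\<xi> + 2 * complex_of_real pi) = A *v X \<xi> + b)"
    by (rule frame_period[OF fr init])
      (simp_all add: strip_def w_def ws_def wt_def ds_def dt_def \<phi>_per)
  then obtain A b where A: "rotation_matrix A"
    and X_per: "\<And>\<xi>. \<xi> \<in> ?S \<Longrightarrow> A *v X \<xi> + b = X (\<xi> + 2 * complex_of_real pi)" by auto
  let ?T = "\<lambda>x. A *v x + b"
  have AA: "transpose A ** A = mat 1" "A ** transpose A = mat 1"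
    using A by (auto simp: rotation_matrix_def orthogonal_matrix_def)
  have "bij ?T"
    by (rule o_bij[of "\<lambda>x. transpose A *v (x - b)"])
      (auto simp: fun_eq_iff matrix_vector_mul_assoc AA simp del: transpose_matrix_vector)
  then have orbit: "?T ` X ` strip0 R \<epsilon> = X ` ((\<lambda>\<xi>. \<xi> + 2 * complex_of_real pi) ` strip0 R \<epsilon>)"
      "X ` strip R \<epsilon> = (\<Union>m::int. ipow ?T m ` X ` strip0 R \<epsilon>)"
    using orbit_of_fundamental_piece[of ?T R \<epsilon> X] X_per by blast+
  have metric: "v (exp (- \<i> * \<xi>)) = ln (1 / ((exp (w \<xi>))\<^sup>2 * (cmod (exp (- \<i> * \<xi>)))\<^sup>2))" for \<xi>
  proof -
    have "(exp (w \<xi>))\<^sup>2 * (cmod (\<phi> \<xi>))\<^sup>2 = exp (2 * w \<xi> + 2 * Im \<xi>)"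
      by (simp add: cmod_\<phi> exp_add exp_double)
    also have "\<dots> = exp (- v (\<phi> \<xi>))" by (simp add: w_def)
    finally have "ln (1 / ((exp (w \<xi>))\<^sup>2 * (cmod (\<phi> \<xi>))\<^sup>2)) = v (\<phi> \<xi>)"
      by (simp add: exp_minus divide_inverse)
    then show ?thesis by (simp add: \<phi>_def)
  qed
  have "rigid_motion ?T" unfolding rigid_motion_def using A by blast
  then show ?thesis
    using frame_minimal[OF fr init(1-3)] metric O1 O2 orbit
    by (intro exI[of _ X] exI[of _ O\<^sub>1] exI[of _ O\<^sub>2] exI[of _ "\<lambda>\<xi>. exp (w \<xi>)"] exI[of _ ?T] conjI ballI)
qed

end
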